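(* Let $n\ge1$, $f\in L^2(\mathbb R^n)$, $0<\beta<2$ and $\beta\le\alpha<n$. Then $$\int_{\mathbb R^n}|f|^2\,dx\ \ge\ \frac{d_\alpha}{C_\alpha}\int_{\mathbb R^n}|x|^{-\alpha}\Big|\,\big(|x|^{-n+\frac\alpha2}*f\big)(x)\Big|^2dx+\frac{d_\beta}{D_\beta}\int_{\mathbb R^n\times\mathbb R^n}\frac{|h(x)-h(y)|^2}{|x-y|^{n+\beta}}\,|x|^{-(n-\beta)/2}|y|^{-(n-\beta)/2}\,dx\,dy,$$ where $$h(x)=|x|^{(n-\beta)/2}\,\big(|x|^{-n+\frac\beta2}*f\big)(x),$$ $$C_\alpha=\pi^\alpha\left[\frac{\Gamma(\frac{n-\alpha}4)}{\Gamma(\frac{n+\alpha}4)}\right]^2,\qquad d_\gamma=\pi^{-(n-\gamma)}\left[\frac{\Gamma(\frac{2n-\gamma}4)}{\Gamma(\frac\gamma4)}\right]^2\ (\gamma=\alpha,\beta),\qquad D_\beta=\frac4\beta\,\pi^{\frac n2+\beta}\,\frac{\Gamma(1-\frac\beta2)}{\Gamma(\frac{n+\beta}2)}.$$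
   Context: Here $|x|^{-n+\gamma/2}*f$ denotes the convolution $\int_{\mathbb R^n}|x-y|^{-n+\gamma/2}f(y)\,dy$. *)

theory Defs
  imports "HOL-Analysis.Analysis"
begin

text \<open>The convolution of \<open>f\<close> with \<open>|x| powr (-n + \<gamma>/2)\<close> on \<open>\<real>\<^sup>n\<close>, where \<open>n = CARD('n)\<close>.
  For square-integrable \<open>f\<close> and \<open>0 < \<gamma> < n\<close> the integral converges absolutely for almost
  every \<open>x\<close>; on the exceptional null set its value is \<open>0\<close> by the convention for the
  Bochner integral.\<close>

definition riesz_conv :: "real \<Rightarrow> (real ^ 'n \<Rightarrow> complex) \<Rightarrow> real ^ 'n \<Rightarrow> complex" where
  "riesz_conv \<gamma> f x =
     (LINT y|lebesgue. (norm (x - y) powr (- real CARD('n) + \<gamma> / 2)) *\<^sub>R f y)"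

definition h_fun :: "real \<Rightarrow> (real ^ 'n \<Rightarrow> complex) \<Rightarrow> real ^ 'n \<Rightarrow> complex" where
  "h_fun \<beta> f x = (norm x powr ((real CARD('n) - \<beta>) / 2)) *\<^sub>R riesz_conv \<beta> f x"

definition C_const :: "nat \<Rightarrow> real \<Rightarrow> real" where
  "C_const n \<alpha> = pi powr \<alpha> * (Gamma ((real n - \<alpha>) / 4) / Gamma ((real n + \<alpha>) / 4))\<^sup>2"

definition d_const :: "nat \<Rightarrow> real \<Rightarrow> real" where
  "d_const n \<gamma> = pi powr (- (real n - \<gamma>)) * (Gamma ((2 * real n - \<gamma>) / 4) / Gamma (\<gamma> / 4))\<^sup>2"

definition D_const :: "nat \<Rightarrow> real \<Rightarrow> real" where
  "D_const n \<beta> = 4 / \<beta> * pi powr (real n / 2 + \<beta>) * (Gamma (1 - \<beta> / 2) / Gamma ((real n + \<beta>) / 2))"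

end

theory Submission imports Defs "HOL-Probability.Distributions" begin

text \<open>
  Let \<open>G\<^sub>r\<close> denote the kernel of the Fourier multiplier \<open>\<bar>\<xi>\<bar> powr (- 2 * r)\<close>, so that
  \<open>G\<^sub>r * G\<^sub>s = G\<^sub>r\<^sub>+\<^sub>s\<close>.  The constant \<open>d_const\<close> is chosen such that \<open>G\<^sub>\<gamma>\<^sub>/\<^sub>4\<close> is
  \<open>sqrt d\<^sub>\<gamma>\<close> times \<open>\<bar>x\<bar> powr (- n + \<gamma>/2)\<close>.  Put \<open>g = G\<^sub>\<beta>\<^sub>/\<^sub>4 * f\<close>.  Then the squared norm of
  \<open>f\<close> is the quadratic form of the multiplier \<open>\<bar>\<xi>\<bar> powr \<beta>\<close> at \<open>g\<close>, that is, the double integral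
  of \<open>(g x - g y)\<^sup>2 / \<bar>x - y\<bar> powr (n + \<beta>)\<close> up to a constant.  For a positive function \<open>\<omega>\<close> and
  \<open>h = g / \<omega>\<close> one has
  \<open>(g x - g y)\<^sup>2 = (h x - h y)\<^sup>2 \<omega> x \<omega> y + (g x)\<^sup>2 (1 - \<omega> y / \<omega> x) + (g y)\<^sup>2 (1 - \<omega> x / \<omega> y)\<close>,
  and if \<open>\<omega> = \<bar>x\<bar> powr (- (n - \<beta>)/2)\<close>, the ground state of the operator minus the Hardy potential, then
  the last two terms integrate to \<open>\<bar>x\<bar> powr (- \<beta>) (g x)\<^sup>2 / C\<^sub>\<beta>\<close>.  This gives the case
  \<open>\<alpha> = \<beta>\<close> (\<open>ground_state_inequality\<close>).  For \<open>\<alpha> > \<beta>\<close> the potential \<open>G\<^sub>\<alpha>\<^sub>/\<^sub>4 * f\<close> is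
  \<open>G\<^sub>q * g\<close> with \<open>q = (\<alpha> - \<beta>)/4\<close>, and Schur's test bounds its weighted norm by that of \<open>g\<close>
  with the sharp constant \<open>C\<^sub>\<alpha> / C\<^sub>\<beta>\<close> (\<open>stein_weiss\<close>).

  No Fourier analysis is used.  All kernels are superpositions of Gaussians, and convolving two
  such superpositions convolves their weights on the half-line (\<open>conv_mixture\<close>).  The singular
  jump kernel has the weight \<open>t powr (- \<beta>/2 - 1)\<close>; cutting it off at \<open>t > \<epsilon>\<close> makes it integrable and
  turns the operator into a multiple of the identity minus a convolution.  One integration by
  parts on the half-line (\<open>conv_weight_levy\<close>) then yields both facts that are needed: the truncated operator
  maps \<open>G\<^sub>\<beta>\<^sub>/\<^sub>2\<close> to a positive kernel of mass at most \<open>1\<close>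
  (\<open>nn_integral_approx_delta\<close>), which bounds the quadratic form by the norm of \<open>f\<close>, and it maps
  \<open>\<omega>\<close> to at least an approximation of the Hardy potential times \<open>\<omega>\<close>
  (\<open>levy_supersolution\<close>).

  Only an inequality is claimed, so the identities are arranged without subtraction: \<open>f\<close> is
  split into its positive and negative part, every integral has a nonnegative integrand and is
  defined in \<open>ennreal\<close>, finite terms are cancelled at the end
  (\<open>ground_state_truncated\<close>), and the limits \<open>\<epsilon> \<rightarrow> 0\<close> and of truncations of \<open>f\<close> are taken by
  Fatou's lemma.\<close>

section \<open>Convolution of nonnegative functions\<close>

definition conv :: "('a::euclidean_space \<Rightarrow> ennreal) \<Rightarrow> ('a \<Rightarrow> ennreal) \<Rightarrow> 'a \<Rightarrow> ennreal" where
  "conv F G x = (\<integral>\<^sup>+y. F (x - y) * G y \<partial>lborel)"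

lemma measurable_conv [measurable]:
  assumes [measurable]: "F \<in> borel_measurable borel" "G \<in> borel_measurable borel"
  shows "conv F G \<in> borel_measurable borel"
  unfolding conv_def by measurable

lemma nn_integral_translate:
  fixes F :: "'a::euclidean_space \<Rightarrow> ennreal"
  assumes [measurable]: "F \<in> borel_measurable borel"
  shows "(\<integral>\<^sup>+x. F (x + c) \<partial>lborel) = (\<integral>\<^sup>+x. F x \<partial>lborel)"
proof -
  have "(\<integral>\<^sup>+x. F x \<partial>lborel) = (\<integral>\<^sup>+x. F x \<partial>distr lborel borel ((+) c))"
    by (simp add: lborel_distr_plus)
  also have "\<dots> = (\<integral>\<^sup>+x. F (x + c) \<partial>lborel)"
    by (subst nn_integral_distr) (auto simp: add.commute)
  finally show ?thesis by simp
qed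

lemma nn_integral_reflect:
  fixes F :: "'a::euclidean_space \<Rightarrow> ennreal"
  assumes [measurable]: "F \<in> borel_measurable borel"
  shows "(\<integral>\<^sup>+x. F (c - x) \<partial>lborel) = (\<integral>\<^sup>+x. F x \<partial>lborel)"
proof -
  have "(\<integral>\<^sup>+x. F x \<partial>lborel) = (\<integral>\<^sup>+x. F x \<partial>density (distr lborel borel (\<lambda>x. c + (- 1) *\<^sub>R x)) (\<lambda>_. ennreal (\<bar>- 1\<bar> ^ DIM('a))))"
    by (subst lborel_affine[of "- 1" c, symmetric]) auto
  also have "\<dots> = (\<integral>\<^sup>+x. F (c - x) \<partial>lborel)"
    by (subst nn_integral_density) (auto simp: nn_integral_distr)
  finally show ?thesis by simp
qed

lemma conv_commute:
  assumes [measurable]: "F \<in> borel_measurable borel" "G \<in> borel_measurable borel"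
  shows "conv F G = conv G F"
proof
  fix x
  show "conv F G x = conv G F x"
    unfolding conv_def
    by (subst nn_integral_reflect[of "\<lambda>y. F (x - y) * G y" x, symmetric]) (auto simp: mult.commute)
qed

lemma conv_cong_AE:
  assumes "AE x in lborel. G x = G' x"
  shows "conv F G = conv F G'"
  unfolding conv_def by (rule ext, rule nn_integral_cong_AE) (use assms in auto)

lemma conv_mono_AE:
  assumes "AE x in lborel. G x \<le> G' x"
  shows "conv F G x \<le> conv F G' x"
  unfolding conv_def
  by (rule nn_integral_mono_AE) (use assms in \<open>auto elim!: eventually_mono intro: mult_left_mono\<close>)

lemma conv_add_right:
  assumes [measurable]: "F \<in> borel_measurable borel" "G \<in> borel_measurable borel" "H \<in> borel_measurable borel"
  shows "conv F (\<lambda>x. G x + H x) x = conv F G x + conv F H x"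
  unfolding conv_def by (simp add: distrib_left nn_integral_add)

lemma conv_cmult_right:
  assumes [measurable]: "F \<in> borel_measurable borel" "G \<in> borel_measurable borel"
  shows "conv F (\<lambda>x. c * G x) x = c * conv F G x"
  unfolding conv_def by (subst nn_integral_cmult[symmetric]) (auto simp: mult_ac)

lemma conv_assoc:
  assumes [measurable]: "F \<in> borel_measurable borel" "G \<in> borel_measurable borel" "H \<in> borel_measurable borel"
  shows "conv (conv F G) H = conv F (conv G H)"
proof
  fix x
  have "conv (conv F G) H x = (\<integral>\<^sup>+y. (\<integral>\<^sup>+z. F (x - y - z) * G z * H y \<partial>lborel) \<partial>lborel)"
    unfolding conv_def by (simp add: nn_integral_multc)
  also have "\<dots> = (\<integral>\<^sup>+y. (\<integral>\<^sup>+z. F (x - z) * G (z - y) * H y \<partial>lborel) \<partial>lborel)"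
  proof (rule nn_integral_cong)
    fix y
    show "(\<integral>\<^sup>+z. F (x - y - z) * G z * H y \<partial>lborel) = (\<integral>\<^sup>+z. F (x - z) * G (z - y) * H y \<partial>lborel)"
      by (subst nn_integral_translate[of "\<lambda>z. F (x - y - z) * G z * H y" "- y", symmetric]) auto
  qed
  also have "\<dots> = (\<integral>\<^sup>+z. (\<integral>\<^sup>+y. F (x - z) * G (z - y) * H y \<partial>lborel) \<partial>lborel)"
    by (rule lborel_pair.Fubini') measurable
  also have "\<dots> = conv F (conv G H) x"
    unfolding conv_def by (simp add: nn_integral_cmult mult.assoc)
  finally show "conv (conv F G) H x = conv F (conv G H) x" .
qed

lemma conv_adjoint:
  assumes [measurable]: "F \<in> borel_measurable borel" "u \<in> borel_measurable borel" "v \<in> borel_measurable borel"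
    and even: "\<And>x. F (- x) = F x"
  shows "(\<integral>\<^sup>+x. conv F u x * v x \<partial>lborel) = (\<integral>\<^sup>+x. u x * conv F v x \<partial>lborel)"
proof -
  have *: "F (x - y) = F (y - x)" for x y
    using even[of "x - y"] by simp
  have "(\<integral>\<^sup>+x. conv F u x * v x \<partial>lborel) = (\<integral>\<^sup>+x. (\<integral>\<^sup>+y. F (x - y) * u y * v x \<partial>lborel) \<partial>lborel)"
    unfolding conv_def by (simp add: nn_integral_multc)
  also have "\<dots> = (\<integral>\<^sup>+y. (\<integral>\<^sup>+x. F (x - y) * u y * v x \<partial>lborel) \<partial>lborel)"
    by (rule lborel_pair.Fubini') measurable
  also have "\<dots> = (\<integral>\<^sup>+y. u y * conv F v y \<partial>lborel)"
    unfolding conv_def by (subst *) (simp add: nn_integral_cmult[symmetric] mult_ac)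
  finally show ?thesis .
qed

section \<open>Gaussian mixtures\<close>

text \<open>Normalised so that the Fourier transform with respect to \<open>exp (- 2 \<pi> \<i> x \<bullet> \<xi>)\<close> is
  \<open>exp (- s \<bar>\<xi>\<bar>\<^sup>2)\<close>.\<close>
definition heat :: "real \<Rightarrow> 'a::euclidean_space \<Rightarrow> real" where
  "heat s x = (pi / s) powr (DIM('a) / 2) * exp (- (pi\<^sup>2 * (norm x)\<^sup>2 / s))"

lemma measurable_heat [measurable]:
  "(\<lambda>(s, x). heat s x) \<in> borel_measurable (borel \<Otimes>\<^sub>M borel)"
  "heat s \<in> borel_measurable borel"
  unfolding heat_def by measurable

lemma measurable_heat_comp [measurable (raw)]:
  assumes [measurable]: "f \<in> borel_measurable M" "g \<in> borel_measurable M"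
  shows "(\<lambda>w. heat (f w) (g w)) \<in> borel_measurable M"
  unfolding heat_def by measurable

lemma heat_nonneg [simp]: "0 \<le> heat s x"
  by (simp add: heat_def)

lemma heat_pos: "0 < s \<Longrightarrow> 0 < heat s x"
  by (simp add: heat_def)

lemma heat_minus [simp]: "heat s (- x) = heat s x"
  by (simp add: heat_def)

lemma nn_integral_gaussian_real:
  assumes "0 < s"
  shows "(\<integral>\<^sup>+x. ennreal (exp (- (pi\<^sup>2 * x\<^sup>2 / s))) \<partial>lborel) = ennreal (sqrt (s / pi))"
proof -
  define \<sigma> where "\<sigma> = sqrt (s / (2 * pi\<^sup>2))"
  have \<sigma>: "0 < \<sigma>" "\<sigma>\<^sup>2 = s / (2 * pi\<^sup>2)"
    using assms by (auto simp: \<sigma>_def)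
  have sq: "sqrt (2 * pi * \<sigma>\<^sup>2) = sqrt (s / pi)"
    unfolding \<sigma>(2) using assms by (simp add: field_simps power2_eq_square)
  have pos: "0 < sqrt (s / pi)" using assms by simp
  have "ennreal (exp (- (pi\<^sup>2 * x\<^sup>2 / s))) = ennreal (sqrt (s / pi)) * ennreal (normal_density 0 \<sigma> x)" for x
    unfolding normal_density_def sq using pos assms
    by (subst ennreal_mult[symmetric]) (auto simp: \<sigma> field_simps)
  then have "(\<integral>\<^sup>+x. ennreal (exp (- (pi\<^sup>2 * x\<^sup>2 / s))) \<partial>lborel)
      = ennreal (sqrt (s / pi)) * (\<integral>\<^sup>+x. normal_density 0 \<sigma> x \<partial>lborel)"
    by (simp add: nn_integral_cmult)
  also have "(\<integral>\<^sup>+x. normal_density 0 \<sigma> x \<partial>lborel) = 1"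
    using prob_space.emeasure_space_1[OF prob_space_normal_density[OF \<sigma>(1)]]
    by (simp add: emeasure_density)
  finally show ?thesis by simp
qed

lemma nn_integral_heat:
  assumes "0 < s"
  shows "(\<integral>\<^sup>+x. ennreal (heat s (x::'a::euclidean_space)) \<partial>lborel) = 1"
proof -
  have e: "ennreal (exp (- (pi\<^sup>2 * (norm x)\<^sup>2 / s))) = (\<Prod>b\<in>Basis. ennreal (exp (- (pi\<^sup>2 * (x \<bullet> b)\<^sup>2 / s))))" for x :: 'a
  proof -
    have "(norm x)\<^sup>2 = (\<Sum>b\<in>Basis. (x \<bullet> b)\<^sup>2)"
      unfolding power2_norm_eq_inner by (subst euclidean_inner) (simp add: power2_eq_square)
    then have "exp (- (pi\<^sup>2 * (norm x)\<^sup>2 / s)) = (\<Prod>b\<in>Basis. exp (- (pi\<^sup>2 * (x \<bullet> b)\<^sup>2 / s)))"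
      by (simp add: exp_sum[symmetric] sum_negf sum_divide_distrib sum_distrib_left)
    then show ?thesis by (simp add: prod_ennreal)
  qed
  have "(\<integral>\<^sup>+x. ennreal (exp (- (pi\<^sup>2 * (norm (x::'a))\<^sup>2 / s))) \<partial>lborel) = (\<Prod>b\<in>(Basis::'a set). ennreal (sqrt (s / pi)))"
    unfolding e by (subst nn_integral_lborel_prod) (auto simp: nn_integral_gaussian_real[OF assms])
  also have "\<dots> = ennreal ((s / pi) powr (DIM('a) / 2))"
    using assms by (simp add: ennreal_power powr_half_sqrt[symmetric] powr_realpow[symmetric] powr_powr)
  finally have i: "(\<integral>\<^sup>+x. ennreal (exp (- (pi\<^sup>2 * (norm (x::'a))\<^sup>2 / s))) \<partial>lborel) = ennreal ((s / pi) powr (DIM('a) / 2))" .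
  have "(\<integral>\<^sup>+x. ennreal (heat s (x::'a)) \<partial>lborel) = ennreal ((pi / s) powr (DIM('a) / 2)) * ennreal ((s / pi) powr (DIM('a) / 2))"
    unfolding i[symmetric] heat_def by (subst nn_integral_cmult[symmetric]) (auto simp: ennreal_mult)
  also have "\<dots> = ennreal ((pi / s * (s / pi)) powr (DIM('a) / 2))"
    using assms by (subst powr_mult) (auto simp: ennreal_mult)
  also have "\<dots> = 1" using assms by simp
  finally show ?thesis .
qed

text \<open>Completing the square: the product of two Gaussians is a constant times a translated
  Gaussian, so the semigroup law follows from the normalisation alone.\<close>
lemma heat_mult:
  fixes x y :: "'a::euclidean_space"
  assumes "0 < s" "0 < t"
  shows "heat s (x - y) * heat t y = heat (s + t) x * heat (s * t / (s + t)) (y - (t / (s + t)) *\<^sub>R x)"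
proof -
  have st: "s + t \<noteq> 0" using assms by simp
  have n: "(norm (u - v))\<^sup>2 = (norm u)\<^sup>2 - 2 * (u \<bullet> v) + (norm v)\<^sup>2" for u v :: 'a
    by (simp add: power2_norm_eq_inner inner_diff inner_commute algebra_simps)
  have eq: "(norm (x - y))\<^sup>2 / s + (norm y)\<^sup>2 / t
      = (norm x)\<^sup>2 / (s + t) + (norm (y - (t / (s + t)) *\<^sub>R x))\<^sup>2 / (s * t / (s + t))"
    unfolding n norm_scaleR inner_scaleR_right power_mult_distrib inner_commute[of y x] power2_abs
    using assms st by (simp add: divide_simps) (simp add: algebra_simps power2_eq_square)
  have neg: "- (pi\<^sup>2 * A / c) + - (pi\<^sup>2 * B / d) = - (pi\<^sup>2 * (A / c + B / d))" for A B c d :: real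
    by (simp add: algebra_simps)
  have "pi / s * (pi / t) = pi / (s + t) * (pi / (s * t / (s + t)))"
    using assms st by simp
  then have p: "(pi / s) powr (DIM('a) / 2) * (pi / t) powr (DIM('a) / 2)
    = (pi / (s + t)) powr (DIM('a) / 2) * (pi / (s * t / (s + t))) powr (DIM('a) / 2)"
    using assms by (simp add: powr_mult[symmetric])
  have e: "exp (- (pi\<^sup>2 * (norm (x - y))\<^sup>2 / s)) * exp (- (pi\<^sup>2 * (norm y)\<^sup>2 / t))
    = exp (- (pi\<^sup>2 * (norm x)\<^sup>2 / (s + t))) * exp (- (pi\<^sup>2 * (norm (y - (t / (s + t)) *\<^sub>R x))\<^sup>2 / (s * t / (s + t))))"
    unfolding mult_exp_exp neg eq ..
  have rearrange: "A * E * (B * F) = A * B * (E * F)" for A B E F :: real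
    by simp
  show ?thesis
    unfolding heat_def rearrange p e ..
qed

lemma heat_semigroup:
  fixes x :: "'a::euclidean_space"
  assumes "0 < s" "0 < t"
  shows "(\<integral>\<^sup>+y. ennreal (heat s (x - y)) * ennreal (heat t y) \<partial>lborel) = ennreal (heat (s + t) x)"
proof -
  have pos: "0 < s * t / (s + t)" using assms by simp
  have "(\<integral>\<^sup>+y. ennreal (heat s (x - y)) * ennreal (heat t y) \<partial>lborel)
     = (\<integral>\<^sup>+y. ennreal (heat (s + t) x) * ennreal (heat (s * t / (s + t)) (y + - ((t / (s + t)) *\<^sub>R x))) \<partial>lborel)"
    by (intro nn_integral_cong) (simp add: ennreal_mult[symmetric] heat_mult[OF assms])
  also have "\<dots> = ennreal (heat (s + t) x) * (\<integral>\<^sup>+y. ennreal (heat (s * t / (s + t)) (y::'a)) \<partial>lborel)"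
    by (subst nn_integral_cmult, simp,
        subst nn_integral_translate[where F="\<lambda>y. ennreal (heat (s * t / (s + t)) y)"]) simp_all
  finally show ?thesis by (simp add: nn_integral_heat[OF pos])
qed

definition mixture :: "(real \<Rightarrow> ennreal) \<Rightarrow> 'a::euclidean_space \<Rightarrow> ennreal" where
  "mixture \<mu> x = (\<integral>\<^sup>+s. \<mu> s * ennreal (heat s x) \<partial>lborel)"

lemma measurable_mixture [measurable]:
  assumes [measurable]: "\<mu> \<in> borel_measurable borel"
  shows "mixture \<mu> \<in> borel_measurable borel"
  unfolding mixture_def by measurable

lemma mixture_minus [simp]: "mixture \<mu> (- x) = mixture \<mu> x"
  by (simp add: mixture_def)

lemma mixture_mono:
  assumes "\<And>s. \<mu> s \<le> \<nu> s"
  shows "mixture \<mu> x \<le> mixture \<nu> x"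
  unfolding mixture_def by (intro nn_integral_mono mult_right_mono assms) auto

lemma mixture_add:
  assumes [measurable]: "\<mu> \<in> borel_measurable borel" "\<nu> \<in> borel_measurable borel"
  shows "mixture (\<lambda>s. \<mu> s + \<nu> s) x = mixture \<mu> x + mixture \<nu> x"
  unfolding mixture_def by (simp add: distrib_right nn_integral_add)

lemma mixture_cmult:
  assumes [measurable]: "\<mu> \<in> borel_measurable borel"
  shows "mixture (\<lambda>s. c * \<mu> s) x = c * mixture \<mu> x"
  unfolding mixture_def by (simp add: nn_integral_cmult mult.assoc)

lemma nn_integral_mixture:
  assumes [measurable]: "\<mu> \<in> borel_measurable borel" and supp: "\<And>s. s \<le> 0 \<Longrightarrow> \<mu> s = 0"
  shows "(\<integral>\<^sup>+x. mixture \<mu> (x::'a::euclidean_space) \<partial>lborel) = (\<integral>\<^sup>+s. \<mu> s \<partial>lborel)"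
proof -
  have "(\<integral>\<^sup>+x. mixture \<mu> (x::'a) \<partial>lborel) = (\<integral>\<^sup>+s. (\<integral>\<^sup>+x. \<mu> s * ennreal (heat s (x::'a)) \<partial>lborel) \<partial>lborel)"
    unfolding mixture_def by (rule lborel_pair.Fubini') measurable
  also have "\<dots> = (\<integral>\<^sup>+s. \<mu> s \<partial>lborel)"
  proof (rule nn_integral_cong)
    fix s
    show "(\<integral>\<^sup>+x. \<mu> s * ennreal (heat s (x::'a)) \<partial>lborel) = \<mu> s"
      by (cases "0 < s") (auto simp: nn_integral_cmult nn_integral_heat supp)
  qed
  finally show ?thesis .
qed

text \<open>Convolving two mixtures convolves their weights, because \<open>heat s\<close> is a convolution
  semigroup in \<open>s\<close>.  Every convolution identity between radial kernels below is thereby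
  reduced to an identity between functions on the half-line.\<close>
lemma conv_mixture:
  assumes [measurable]: "\<mu> \<in> borel_measurable borel" "\<nu> \<in> borel_measurable borel"
    and supp: "\<And>s. s \<le> 0 \<Longrightarrow> \<mu> s = 0" "\<And>s. s \<le> 0 \<Longrightarrow> \<nu> s = 0"
  shows "conv (mixture \<mu>) (mixture \<nu>) (x::'a::euclidean_space) = mixture (conv \<mu> \<nu>) x"
proof -
  have "conv (mixture \<mu>) (mixture \<nu>) x
      = (\<integral>\<^sup>+y. (\<integral>\<^sup>+t. (\<integral>\<^sup>+s. \<mu> s * ennreal (heat s (x - y)) * (\<nu> t * ennreal (heat t y)) \<partial>lborel) \<partial>lborel) \<partial>lborel)"
    unfolding conv_def mixture_def by (simp add: nn_integral_multc nn_integral_cmult)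
  also have "\<dots> = (\<integral>\<^sup>+t. (\<integral>\<^sup>+y. (\<integral>\<^sup>+s. \<mu> s * ennreal (heat s (x - y)) * (\<nu> t * ennreal (heat t y)) \<partial>lborel) \<partial>lborel) \<partial>lborel)"
    by (rule lborel_pair.Fubini') measurable
  also have "\<dots> = (\<integral>\<^sup>+t. (\<integral>\<^sup>+s. (\<integral>\<^sup>+y. \<mu> s * ennreal (heat s (x - y)) * (\<nu> t * ennreal (heat t y)) \<partial>lborel) \<partial>lborel) \<partial>lborel)"
    by (intro nn_integral_cong lborel_pair.Fubini') measurable
  also have "\<dots> = (\<integral>\<^sup>+t. (\<integral>\<^sup>+s. \<mu> s * \<nu> t * ennreal (heat (s + t) x) \<partial>lborel) \<partial>lborel)"
  proof (intro nn_integral_cong)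
    fix s t :: real
    have "(\<integral>\<^sup>+y. \<mu> s * ennreal (heat s (x - y)) * (\<nu> t * ennreal (heat t y)) \<partial>lborel)
        = \<mu> s * \<nu> t * (\<integral>\<^sup>+y. ennreal (heat s (x - y)) * ennreal (heat t y) \<partial>lborel)"
      by (subst nn_integral_cmult[symmetric]) (auto simp: mult_ac)
    then show "(\<integral>\<^sup>+y. \<mu> s * ennreal (heat s (x - y)) * (\<nu> t * ennreal (heat t y)) \<partial>lborel)
        = \<mu> s * \<nu> t * ennreal (heat (s + t) x)"
      by (cases "0 < s \<and> 0 < t") (auto simp: heat_semigroup supp not_less)
  qed
  also have "\<dots> = (\<integral>\<^sup>+t. (\<integral>\<^sup>+s. \<mu> (s - t) * \<nu> t * ennreal (heat s x) \<partial>lborel) \<partial>lborel)"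
  proof (rule nn_integral_cong)
    fix t
    show "(\<integral>\<^sup>+s. \<mu> s * \<nu> t * ennreal (heat (s + t) x) \<partial>lborel) = (\<integral>\<^sup>+s. \<mu> (s - t) * \<nu> t * ennreal (heat s x) \<partial>lborel)"
      by (subst nn_integral_translate[of "\<lambda>s. \<mu> (s - t) * \<nu> t * ennreal (heat s x)" t, symmetric]) auto
  qed
  also have "\<dots> = (\<integral>\<^sup>+s. (\<integral>\<^sup>+t. \<mu> (s - t) * \<nu> t * ennreal (heat s x) \<partial>lborel) \<partial>lborel)"
    by (rule lborel_pair.Fubini') measurable
  also have "\<dots> = mixture (conv \<mu> \<nu>) x"
    unfolding mixture_def conv_def by (simp add: nn_integral_multc)
  finally show ?thesis .
qed

section \<open>Power weights on the half-line\<close>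

text \<open>For \<open>\<epsilon> = 0\<close> and \<open>0 < r\<close> this is the kernel of fractional integration of order \<open>r\<close>; for
  \<open>r = - b\<close> with \<open>0 < b < 1\<close> it is the jump density of the stable subordinator of index \<open>b\<close>, with
  small jumps removed.  As \<open>Gamma (- b) < 0\<close>, the absolute value keeps the density positive.\<close>
definition weight :: "real \<Rightarrow> real \<Rightarrow> real \<Rightarrow> ennreal" where
  "weight \<epsilon> r s = ennreal (indicator {\<epsilon><..} s * s powr (r - 1) / \<bar>Gamma r\<bar>)"

lemma measurable_weight [measurable]: "weight \<epsilon> r \<in> borel_measurable borel"
  unfolding weight_def by measurable

lemma weight_eq_0: "0 \<le> \<epsilon> \<Longrightarrow> s \<le> 0 \<Longrightarrow> weight \<epsilon> r s = 0"
  by (simp add: weight_def)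

lemma abs_Gamma_minus:
  fixes b :: real
  assumes "0 < b" "b < 1"
  shows "\<bar>Gamma (- b)\<bar> = Gamma (1 - b) / b"
proof -
  have "- b \<notin> \<int>\<^sub>\<le>\<^sub>0"
  proof
    assume "- b \<in> \<int>\<^sub>\<le>\<^sub>0"
    then have "- b \<in> \<int>" by (rule nonpos_Ints_Int)
    then obtain k where "- b = of_int k" by (rule Ints_cases)
    with assms have "- 1 < k" "k < 0" by linarith+
    then show False by linarith
  qed
  then have "Gamma (1 - b) = - b * Gamma (- b)"
    using Gamma_plus1[of "- b"] by (simp add: add.commute)
  then show ?thesis
    using assms Gamma_real_pos[of "1 - b"] by (auto simp: field_simps zero_less_mult_iff mult_less_0_iff abs_if)
qed

text \<open>Fractional integrations add their orders; this is Euler's Beta integral.\<close>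
lemma conv_weight:
  assumes c: "0 < c" and d: "0 < d"
  shows "conv (weight 0 c) (weight 0 d) = weight 0 (c + d)"
proof
  fix s :: real
  show "conv (weight 0 c) (weight 0 d) s = weight 0 (c + d) s"
  proof (cases "0 < s")
    case False
    then have z: "weight 0 c (s - t) * weight 0 d t = 0" for t
      by (cases "0 < t") (auto simp: weight_def)
    show ?thesis unfolding conv_def z using False by (simp add: weight_def)
  next
    case s: True
    let ?K = "s powr (c + d - 2) / (Gamma c * Gamma d)"
    have G: "0 < Gamma c" "0 < Gamma d" "0 < Gamma (c + d)" using c d by (auto intro: Gamma_real_pos)
    have e: "weight 0 c (s - s * u) * weight 0 d (s * u)
        = ennreal ?K * (ennreal (u powr (d - 1) * (1 - u) powr (c - 1)) * indicator {0..1} u)" for u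
    proof (cases "0 < u \<and> u < 1")
      case True
      then have "weight 0 c (s - s * u) * weight 0 d (s * u)
        = ennreal ((s * (1 - u)) powr (c - 1) / Gamma c * ((s * u) powr (d - 1) / Gamma d))"
        using s G by (simp add: weight_def ennreal_mult[symmetric] right_diff_distrib)
      also have "(s * (1 - u)) powr (c - 1) / Gamma c * ((s * u) powr (d - 1) / Gamma d)
        = ?K * (u powr (d - 1) * (1 - u) powr (c - 1))"
        unfolding powr_mult using s by (simp add: powr_diff powr_add power2_eq_square field_simps)
      also have "ennreal \<dots> = ennreal ?K * ennreal (u powr (d - 1) * (1 - u) powr (c - 1))"
        using G by (intro ennreal_mult) auto
      finally show ?thesis using True by simp
    next
      case False
      have "s - s * u \<le> 0 \<or> s * u \<le> 0"
        using False s by (cases "0 < u") (auto simp: mult_le_0_iff)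
      then have "weight 0 c (s - s * u) * weight 0 d (s * u) = 0"
        by (auto simp: weight_eq_0)
      with False show ?thesis by (cases "u = 0 \<or> u = 1") (auto simp: indicator_def)
    qed
    have "conv (weight 0 c) (weight 0 d) s = ennreal s * (\<integral>\<^sup>+u. weight 0 c (s - s * u) * weight 0 d (s * u) \<partial>lborel)"
      unfolding conv_def using s
      by (subst nn_integral_real_affine[where c=s and t=0]) auto
    also have "\<dots> = ennreal s * (ennreal ?K * ennreal (Beta d c))"
      unfolding e
      by (subst nn_integral_cmult, simp,
          subst nn_integral_has_integral_lebesgue'[OF _ has_integral_Beta_real[OF d c]]) auto
    also have "\<dots> = ennreal (s * (?K * Beta d c))"
      using s G by (simp add: ennreal_mult[symmetric] Beta_def add.commute)
    also have "s * (?K * Beta d c) = s powr (c + d - 1) / Gamma (c + d)"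
      using s G by (simp add: Beta_def add.commute powr_diff powr_add field_simps power2_eq_square)
    finally show ?thesis using s G by (simp add: weight_def[of _ "c + d"])
  qed
qed

text \<open>The effect of the jumps larger than \<open>\<epsilon>\<close> on a power: the identity integrates
  \<open>d/dt (- t\<^sup>-\<^sup>b (s - t)\<^sup>a) = b s t\<^sup>-\<^sup>b\<^sup>-\<^sup>1 (s - t)\<^sup>a\<^sup>-\<^sup>1 + (a - b) t\<^sup>-\<^sup>b (s - t)\<^sup>a\<^sup>-\<^sup>1\<close> over \<open>{\<epsilon>..s}\<close>.\<close>
lemma conv_weight_levy:
  assumes b: "0 < b" "b < 1" and ab: "b \<le> a" and \<epsilon>: "0 < \<epsilon>" and s: "0 < s"
  shows "conv (weight \<epsilon> (- b)) (weight 0 a) s + ennreal ((a - b) / s) * conv (weight \<epsilon> (1 - b)) (weight 0 a) s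
    = ennreal (indicator {\<epsilon><..} s * (\<epsilon> powr (- b) * (s - \<epsilon>) powr a / (s * Gamma (1 - b) * Gamma a)))"
proof (cases "\<epsilon> < s")
  case False
  then have z: "weight 0 a (s - t) * weight \<epsilon> r t = 0" for r t
    by (cases "\<epsilon> < t") (auto simp: weight_def)
  have "conv (weight 0 a) (weight \<epsilon> r) s = 0" for r
    unfolding conv_def z by simp
  then have "conv (weight \<epsilon> r) (weight 0 a) s = 0" for r
    by (subst conv_commute) auto
  then show ?thesis using False by simp
next
  case True
  have a: "0 < a" using b ab by simp
  have G: "0 < Gamma (1 - b)" "0 < Gamma a" using a b by (auto intro: Gamma_real_pos)
  then have G': "Gamma (1 - b) \<noteq> 0" "Gamma a \<noteq> 0" by simp_all
  let ?D = "s * Gamma (1 - b) * Gamma a"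
  let ?f = "\<lambda>t. (b * s * t powr (- b - 1) * (s - t) powr (a - 1) + (a - b) * t powr (- b) * (s - t) powr (a - 1)) / ?D"
  have "(?f has_integral (- (s powr (- b) * (s - s) powr a) / ?D - (- (\<epsilon> powr (- b) * (s - \<epsilon>) powr a) / ?D))) {\<epsilon>..s}"
  proof (rule fundamental_theorem_of_calculus_interior)
    show "continuous_on {\<epsilon>..s} (\<lambda>t. - (t powr (- b) * (s - t) powr a) / ?D)"
      using a b \<epsilon> G' s by (auto intro!: continuous_intros continuous_on_powr')
    show "((\<lambda>t. - (t powr (- b) * (s - t) powr a) / ?D) has_vector_derivative ?f t) (at t)" if "t \<in> {\<epsilon><..<s}" for t
    proof -
      have t: "0 < t" "0 < s - t" using that \<epsilon> by auto
      have p: "t powr (- b) = t * t powr (- b - 1)" "(s - t) powr a = (s - t) * (s - t) powr (a - 1)"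
        using t by (simp_all add: powr_diff)
      have "((\<lambda>t. - (t powr (- b) * (s - t) powr a) / ?D) has_real_derivative
          (b * t powr (- b - 1) * (s - t) powr a + a * t powr (- b) * (s - t) powr (a - 1)) / ?D) (at t)"
        using t G s by (auto intro!: derivative_eq_intros simp: field_simps)
      also have "(b * t powr (- b - 1) * (s - t) powr a + a * t powr (- b) * (s - t) powr (a - 1)) / ?D = ?f t"
        unfolding p by (simp add: algebra_simps)
      finally show ?thesis by (simp add: has_real_derivative_iff_has_vector_derivative)
    qed
  qed (use True in simp)
  then have "(?f has_integral (\<epsilon> powr (- b) * (s - \<epsilon>) powr a) / ?D) {\<epsilon>..s}"
    by simp
  from nn_integral_has_integral_lebesgue'[OF _ this]
  have I: "(\<integral>\<^sup>+t. ennreal (?f t) * indicator {\<epsilon>..s} t \<partial>lborel) = ennreal ((\<epsilon> powr (- b) * (s - \<epsilon>) powr a) / ?D)"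
    using b ab G s \<epsilon> by simp
  have "conv (weight \<epsilon> (- b)) (weight 0 a) s + ennreal ((a - b) / s) * conv (weight \<epsilon> (1 - b)) (weight 0 a) s
    = (\<integral>\<^sup>+t. weight 0 a (s - t) * weight \<epsilon> (- b) t + ennreal ((a - b) / s) * (weight 0 a (s - t) * weight \<epsilon> (1 - b) t) \<partial>lborel)"
    by (subst (1 2) conv_commute) (simp_all add: conv_def nn_integral_add nn_integral_cmult)
  also have "\<dots> = (\<integral>\<^sup>+t. ennreal (?f t) * indicator {\<epsilon>..s} t \<partial>lborel)"
  proof (intro nn_integral_cong_AE eventually_mono[OF AE_lborel_singleton[of \<epsilon>]])
    fix t assume t: "t \<noteq> \<epsilon>"
    show "weight 0 a (s - t) * weight \<epsilon> (- b) t + ennreal ((a - b) / s) * (weight 0 a (s - t) * weight \<epsilon> (1 - b) t)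
       = ennreal (?f t) * indicator {\<epsilon>..s} t"
    proof (cases "\<epsilon> < t \<and> t < s")
      case False
      then have "weight 0 a (s - t) * weight \<epsilon> r t = 0" for r
        by (cases "t < s") (auto simp: weight_def)
      with False t show ?thesis by (cases "t = s") (auto simp: indicator_def)
    next
      case True
      have "weight 0 a (s - t) * weight \<epsilon> (- b) t + ennreal ((a - b) / s) * (weight 0 a (s - t) * weight \<epsilon> (1 - b) t)
        = ennreal ((s - t) powr (a - 1) / Gamma a * (b * t powr (- b - 1) / Gamma (1 - b))
           + (a - b) / s * ((s - t) powr (a - 1) / Gamma a * (t powr (- b) / Gamma (1 - b))))"
        using True G b ab s by (simp add: weight_def abs_Gamma_minus ennreal_mult[symmetric] ennreal_plus[symmetric] mult.commute del: ennreal_plus)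
      also have "(s - t) powr (a - 1) / Gamma a * (b * t powr (- b - 1) / Gamma (1 - b))
           + (a - b) / s * ((s - t) powr (a - 1) / Gamma a * (t powr (- b) / Gamma (1 - b))) = ?f t"
        using s G by (simp add: field_simps)
      finally show ?thesis using True by simp
    qed
  qed
  finally show ?thesis unfolding I using True by simp
qed

section \<open>The truncated jump operator on the half-line\<close>

lemma conv_weight_eq_0:
  assumes "0 \<le> \<epsilon>" "s \<le> 0"
  shows "conv (weight \<epsilon> r) (weight 0 a) s = 0"
proof -
  have z: "weight \<epsilon> r (s - t) * weight 0 a t = 0" for t
    using assms by (cases "0 < t") (auto simp: weight_eq_0)
  show ?thesis unfolding conv_def z by simp
qed

text \<open>The second term in \<open>conv_weight_levy\<close>.  As \<open>\<epsilon>\<close> tends to \<open>0\<close> it increases to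
  \<open>weight 0 (a - b)\<close>, which for the ground state is the weight of its product with the Hardy
  potential.\<close>
definition hardy_weight :: "real \<Rightarrow> real \<Rightarrow> real \<Rightarrow> real \<Rightarrow> ennreal" where
  "hardy_weight \<epsilon> b a s = ennreal ((a - b) / s) * conv (weight \<epsilon> (1 - b)) (weight 0 a) s"

lemma measurable_hardy_weight [measurable]: "hardy_weight \<epsilon> b a \<in> borel_measurable borel"
  unfolding hardy_weight_def by measurable

text \<open>The right-hand side of \<open>conv_weight_levy\<close> grows when \<open>(s - \<epsilon>) powr a\<close> is replaced by \<open>s powr a\<close>.
  The factor \<open>\<epsilon> powr (- b) / Gamma (1 - b)\<close> is the total mass of \<open>weight \<epsilon> (- b)\<close>, so the inequality
  bounds the truncated jump operator on \<open>weight 0 a\<close> from below.\<close>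
lemma levy_supersolution:
  assumes b: "0 < b" "b < 1" and ab: "b \<le> a" and \<epsilon>: "0 < \<epsilon>"
  shows "conv (weight \<epsilon> (- b)) (weight 0 a) s + hardy_weight \<epsilon> b a s
    \<le> ennreal (\<epsilon> powr (- b) / Gamma (1 - b)) * weight 0 a s"
proof (cases "0 < s")
  case False
  then show ?thesis
    using \<epsilon> by (simp add: hardy_weight_def conv_weight_eq_0)
next
  case True
  have G: "0 < Gamma (1 - b)" "0 < Gamma a" using b ab by (auto intro: Gamma_real_pos)
  have "indicator {\<epsilon><..} s * (\<epsilon> powr (- b) * (s - \<epsilon>) powr a / (s * Gamma (1 - b) * Gamma a))
    \<le> \<epsilon> powr (- b) * s powr a / (s * Gamma (1 - b) * Gamma a)"
    using b ab \<epsilon> True G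
    by (auto simp: indicator_def intro!: divide_right_mono mult_left_mono powr_mono2)
  also have "\<dots> = \<epsilon> powr (- b) / Gamma (1 - b) * (s powr (a - 1) / Gamma a)"
    using True G by (simp add: powr_diff)
  finally have "ennreal (indicator {\<epsilon><..} s * (\<epsilon> powr (- b) * (s - \<epsilon>) powr a / (s * Gamma (1 - b) * Gamma a)))
      \<le> ennreal (\<epsilon> powr (- b) / Gamma (1 - b) * (s powr (a - 1) / Gamma a))"
    by (rule ennreal_leI)
  also have "\<dots> = ennreal (\<epsilon> powr (- b) / Gamma (1 - b)) * weight 0 a s"
    using True G by (subst ennreal_mult) (auto simp: weight_def)
  finally show ?thesis
    using conv_weight_levy[OF b ab \<epsilon> True] by (simp add: hardy_weight_def)
qed

lemma weight_antimono: "\<delta> \<le> \<epsilon> \<Longrightarrow> weight \<epsilon> r s \<le> weight \<delta> r s"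
  unfolding weight_def by (intro ennreal_leI divide_right_mono mult_right_mono) (auto simp: indicator_def)

lemma conv_mono_left: "(\<And>x. F x \<le> F' x) \<Longrightarrow> conv F G x \<le> conv F' G x"
  unfolding conv_def by (intro nn_integral_mono mult_right_mono) auto

lemma weight_incseq: "incseq (\<lambda>k. weight (1 / real (Suc k)) r s)"
  by (intro incseq_SucI weight_antimono) (auto intro!: divide_left_mono)

lemma weight_tendsto: "(\<lambda>k. weight (1 / real (Suc k)) r s) \<longlonglongrightarrow> weight 0 r s"
proof (cases "0 < s")
  case False
  then have "weight (1 / real (Suc k)) r s = weight 0 r s" for k
    by (simp add: weight_eq_0)
  then show ?thesis by simp
next
  case True
  have "(\<lambda>k. 1 / real (Suc k)) \<longlonglongrightarrow> 0"
    using LIMSEQ_inverse_real_of_nat by (simp add: inverse_eq_divide)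
  then have "eventually (\<lambda>k. 1 / real (Suc k) < s) sequentially"
    using True by (rule order_tendstoD)
  then have "eventually (\<lambda>k. weight 0 r s = weight (1 / real (Suc k)) r s) sequentially"
    by eventually_elim (use True in \<open>simp add: weight_def\<close>)
  then show ?thesis
    by (rule Lim_transform_eventually[OF tendsto_const])
qed

lemma conv_incseq_tendsto:
  assumes [measurable]: "\<And>k. F k \<in> borel_measurable borel" "G \<in> borel_measurable borel"
    and inc: "\<And>x. incseq (\<lambda>k. F k x)" and lim: "\<And>x. (\<lambda>k. F k x) \<longlonglongrightarrow> F' x"
    and fin: "\<And>x. G x < top"
  shows "(\<lambda>k. conv (F k) G x) \<longlonglongrightarrow> conv F' G x"
  unfolding conv_def
proof (rule nn_integral_LIMSEQ)
  show "incseq (\<lambda>k y. F k (x - y) * G y)"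
    using inc by (auto simp: incseq_def le_fun_def intro!: mult_right_mono)
  show "(\<lambda>k. F k (x - y) * G y) \<longlonglongrightarrow> F' (x - y) * G y" for y
    using ennreal_tendsto_cmult[OF fin lim, of y "x - y"] by (simp add: mult.commute)
qed simp

lemma mixture_incseq_tendsto:
  assumes [measurable]: "\<And>k. \<mu> k \<in> borel_measurable borel"
    and inc: "\<And>x. incseq (\<lambda>k. \<mu> k x)" and lim: "\<And>x. (\<lambda>k. \<mu> k x) \<longlonglongrightarrow> \<mu>' x"
  shows "(\<lambda>k. mixture (\<mu> k) x) \<longlonglongrightarrow> mixture \<mu>' x"
  unfolding mixture_def
proof (rule nn_integral_LIMSEQ)
  show "incseq (\<lambda>k s. \<mu> k s * ennreal (heat s x))"
    using inc by (auto simp: incseq_def le_fun_def intro!: mult_right_mono)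
  show "(\<lambda>k. \<mu> k s * ennreal (heat s x)) \<longlonglongrightarrow> \<mu>' s * ennreal (heat s x)" for s
    using ennreal_tendsto_cmult[OF ennreal_less_top lim, of "heat s x" s] by (simp add: mult.commute)
qed simp

lemma hardy_weight_incseq: "incseq (\<lambda>k. hardy_weight (1 / real (Suc k)) b a s)"
  unfolding hardy_weight_def
  by (intro incseq_SucI mult_left_mono conv_mono_left weight_antimono) (auto intro!: divide_left_mono)

text \<open>Without truncation the convolution is a Beta integral, and the factor \<open>a - b\<close> is absorbed by
  the functional equation of the Gamma function.\<close>
lemma hardy_weight_tendsto:
  assumes b: "0 < b" "b < 1" and ab: "b < a"
  shows "(\<lambda>k. hardy_weight (1 / real (Suc k)) b a s) \<longlonglongrightarrow> weight 0 (a - b) s"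
proof -
  have lim: "(\<lambda>k. hardy_weight (1 / real (Suc k)) b a s) \<longlonglongrightarrow> ennreal ((a - b) / s) * conv (weight 0 (1 - b)) (weight 0 a) s"
    unfolding hardy_weight_def
    by (intro ennreal_tendsto_cmult ennreal_less_top conv_incseq_tendsto weight_incseq weight_tendsto)
      (simp_all add: weight_def)
  also have "conv (weight 0 (1 - b)) (weight 0 a) = weight 0 (1 - b + a)"
    using b ab by (intro conv_weight) auto
  also have "ennreal ((a - b) / s) * weight 0 (1 - b + a) s = weight 0 (a - b) s"
  proof (cases "0 < s")
    case True
    have G: "0 < Gamma (a - b)" using ab by simp
    have "a - b \<notin> \<int>\<^sub>\<le>\<^sub>0" using ab by (auto dest: nonpos_Ints_nonpos)
    then have "Gamma (1 - b + a) = (a - b) * Gamma (a - b)"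
      using Gamma_plus1[of "a - b"] by (simp add: add.commute add_diff_eq diff_add_eq)
    moreover have "s powr (1 - b + a - 1) = s * s powr (a - b - 1)"
      using powr_mult_base[of s "a - b - 1"] True by (simp add: algebra_simps)
    ultimately have "(a - b) / s * (s powr (1 - b + a - 1) / \<bar>Gamma (1 - b + a)\<bar>) = s powr (a - b - 1) / \<bar>Gamma (a - b)\<bar>"
      using True ab by (simp add: abs_mult)
    then show ?thesis
      using True ab by (simp add: weight_def ennreal_mult[symmetric])
  qed (simp add: weight_eq_0)
  finally show ?thesis .
qed

text \<open>The truncated jump operator applied to \<open>weight 0 b\<close>, which inverts the untruncated operator;
  hence an approximation of the Dirac measure at \<open>0\<close>.\<close>
definition approx_delta :: "real \<Rightarrow> real \<Rightarrow> real \<Rightarrow> ennreal" where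
  "approx_delta \<epsilon> b s = ennreal (\<epsilon> powr (- b) / Gamma (1 - b)) * weight 0 b s - conv (weight \<epsilon> (- b)) (weight 0 b) s"

lemma measurable_approx_delta [measurable]: "approx_delta \<epsilon> b \<in> borel_measurable borel"
  unfolding approx_delta_def by measurable

lemma approx_delta_eq_0: "s \<le> 0 \<Longrightarrow> approx_delta \<epsilon> b s = 0"
  by (simp add: approx_delta_def weight_eq_0)

lemma approx_delta_add:
  assumes b: "0 < b" "b < 1" and \<epsilon>: "0 < \<epsilon>"
  shows "conv (weight \<epsilon> (- b)) (weight 0 b) s + approx_delta \<epsilon> b s = ennreal (\<epsilon> powr (- b) / Gamma (1 - b)) * weight 0 b s"
proof -
  have "conv (weight \<epsilon> (- b)) (weight 0 b) s \<le> ennreal (\<epsilon> powr (- b) / Gamma (1 - b)) * weight 0 b s"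
    using levy_supersolution[OF b order.refl \<epsilon>, of s] by (simp add: hardy_weight_def)
  then show ?thesis
    unfolding approx_delta_def by (rule add_diff_inverse_ennreal)
qed

text \<open>Convolution with \<open>weight 0 1\<close> is integration from \<open>0\<close> to \<open>s\<close>, so the mass up to \<open>s\<close> is
  governed by the identity for the exponent \<open>b + 1\<close>; letting \<open>s\<close> tend to infinity leaves \<open>1\<close>.\<close>
lemma nn_integral_approx_delta:
  assumes b: "0 < b" "b < 1" and \<epsilon>: "0 < \<epsilon>"
  shows "(\<integral>\<^sup>+s. approx_delta \<epsilon> b s \<partial>lborel) \<le> 1"
proof -
  let ?m = "\<epsilon> powr (- b) / Gamma (1 - b)"
  let ?\<kappa> = "approx_delta \<epsilon> b" and ?\<rho> = "weight \<epsilon> (- b)"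
  have G: "0 < Gamma (1 - b)" "0 < Gamma (b + 1)" using b by (auto intro: Gamma_real_pos)
  define C where "C = 2 * \<epsilon> * (?m / Gamma (b + 1))"
  have C: "0 \<le> C" using \<epsilon> G by (simp add: C_def)
  have partial: "(\<integral>\<^sup>+t. ?\<kappa> t * indicator {..<s} t \<partial>lborel) \<le> ennreal (1 + C * s powr (b - 1))" if s: "\<epsilon> < s" for s
  proof -
    have s0: "0 < s" using s \<epsilon> by simp
    have \<kappa>1: "conv ?\<kappa> (weight 0 1) s = (\<integral>\<^sup>+t. ?\<kappa> t * indicator {..<s} t \<partial>lborel)"
      by (subst conv_commute) (auto simp: conv_def weight_def indicator_def mult.commute intro!: nn_integral_cong)
    have "conv (weight 0 1) (conv ?\<rho> (weight 0 b)) = conv ?\<rho> (weight 0 (b + 1))"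
      using b by (subst conv_commute) (simp_all add: conv_assoc conv_weight)
    moreover have "conv (weight 0 1) ?\<kappa> = conv ?\<kappa> (weight 0 1)"
      by (rule conv_commute) measurable
    ultimately have "conv ?\<rho> (weight 0 (b + 1)) s + conv ?\<kappa> (weight 0 1) s
       = conv (weight 0 1) (\<lambda>t. conv ?\<rho> (weight 0 b) t + ?\<kappa> t) s"
      by (simp add: conv_add_right)
    also have "\<dots> = ennreal ?m * weight 0 (b + 1) s"
      unfolding approx_delta_add[OF b \<epsilon>] using b
      by (simp add: conv_cmult_right conv_weight add.commute)
    finally have sum: "conv ?\<rho> (weight 0 (b + 1)) s + conv ?\<kappa> (weight 0 1) s = ennreal ?m * weight 0 (b + 1) s" .
    have fin: "conv ?\<rho> (weight 0 (b + 1)) s \<noteq> top"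
    proof
      assume "conv ?\<rho> (weight 0 (b + 1)) s = top"
      with sum have "ennreal ?m * weight 0 (b + 1) s = top" by simp
      then show False by (simp add: weight_def ennreal_mult[symmetric] ennreal_mult_eq_top_iff)
    qed
    let ?R = "\<epsilon> powr (- b) * (s - \<epsilon>) powr (b + 1) / (s * Gamma (1 - b) * Gamma (b + 1))"
    have "ennreal ?R = conv ?\<rho> (weight 0 (b + 1)) s + ennreal (1 / s) * conv (weight \<epsilon> (1 - b)) (weight 0 (b + 1)) s"
      using conv_weight_levy[OF b, of "b + 1" \<epsilon> s] s s0 \<epsilon> by simp
    also have "\<dots> \<le> conv ?\<rho> (weight 0 (b + 1)) s + ennreal (1 / s) * conv (weight 0 (1 - b)) (weight 0 (b + 1)) s"
      using \<epsilon> by (intro add_left_mono mult_left_mono conv_mono_left weight_antimono) auto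
    also have "conv (weight 0 (1 - b)) (weight 0 (b + 1)) = weight 0 2"
      using b by (subst conv_weight) auto
    also have "ennreal (1 / s) * weight 0 2 s = 1"
      using s0 by (simp add: weight_def ennreal_mult[symmetric] Gamma_numeral fact_numeral)
    finally have R: "ennreal ?R \<le> conv ?\<rho> (weight 0 (b + 1)) s + 1" .
    have "(s - \<epsilon>)\<^sup>2 * s powr (b - 1) \<le> (s - \<epsilon>)\<^sup>2 * (s - \<epsilon>) powr (b - 1)"
      using b s \<epsilon> by (intro mult_left_mono powr_mono2') auto
    also have "\<dots> = (s - \<epsilon>) powr (b + 1)"
      using s powr_add[of "s - \<epsilon>" 2 "b - 1"] by (simp add: powr_numeral add.commute)
    finally have "s * s powr b - (s - \<epsilon>) powr (b + 1) \<le> s * s powr b - (s - \<epsilon>)\<^sup>2 * s powr (b - 1)"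
      by simp
    also have "s * s powr b = s\<^sup>2 * s powr (b - 1)"
      using s0 by (simp add: powr_diff power2_eq_square)
    also have "s\<^sup>2 * s powr (b - 1) - (s - \<epsilon>)\<^sup>2 * s powr (b - 1) = (2 * \<epsilon> * s - \<epsilon>\<^sup>2) * s powr (b - 1)"
      by (simp add: power2_eq_square algebra_simps)
    also have "\<dots> \<le> 2 * \<epsilon> * s * s powr (b - 1)"
      by (intro mult_right_mono) auto
    finally have diff: "s * s powr b \<le> (s - \<epsilon>) powr (b + 1) + 2 * \<epsilon> * s * s powr (b - 1)"
      using s0 by (simp add: powr_diff power2_eq_square)
    have "?m * (s powr b / Gamma (b + 1)) = ?m / (s * Gamma (b + 1)) * (s * s powr b)"
      using s0 G by (simp add: field_simps)
    also have "\<dots> \<le> ?m / (s * Gamma (b + 1)) * ((s - \<epsilon>) powr (b + 1) + 2 * \<epsilon> * s * s powr (b - 1))"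
      using s0 G diff by (intro mult_left_mono) auto
    also have "\<dots> = ?R + C * s powr (b - 1)"
      using s0 G by (simp add: C_def field_simps)
    finally have "ennreal ?m * weight 0 (b + 1) s \<le> ennreal (?R + C * s powr (b - 1))"
      using s0 G by (simp add: weight_def ennreal_mult[symmetric] ennreal_leI)
    also have "\<dots> = ennreal ?R + ennreal (C * s powr (b - 1))"
      using s s0 G C by (intro ennreal_plus) auto
    also have "\<dots> \<le> conv ?\<rho> (weight 0 (b + 1)) s + (1 + ennreal (C * s powr (b - 1)))"
      using R by (simp add: add.assoc[symmetric] add_right_mono)
    finally have "conv ?\<kappa> (weight 0 1) s \<le> 1 + ennreal (C * s powr (b - 1))"
      unfolding sum[symmetric] using fin by (simp add: ennreal_add_left_cancel_le)
    then show ?thesis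
      unfolding \<kappa>1 using C by (subst ennreal_plus) auto
  qed
  have lim: "(\<lambda>k. \<integral>\<^sup>+t. ?\<kappa> t * indicator {..<real k} t \<partial>lborel) \<longlonglongrightarrow> (\<integral>\<^sup>+t. ?\<kappa> t \<partial>lborel)"
  proof (rule nn_integral_LIMSEQ)
    show "incseq (\<lambda>k t. ?\<kappa> t * indicator {..<real k} t)"
      by (auto simp: incseq_def le_fun_def indicator_def)
    show "(\<lambda>k. ?\<kappa> t * indicator {..<real k} t) \<longlonglongrightarrow> ?\<kappa> t" for t
    proof -
      have "eventually (\<lambda>k. t < real k) sequentially"
        by (meson eventually_sequentiallyI le_less_trans less_le_trans of_nat_le_iff reals_Archimedean2)
      then have "eventually (\<lambda>k. ?\<kappa> t = ?\<kappa> t * indicator {..<real k} t) sequentially"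
        by eventually_elim simp
      then show ?thesis by (rule Lim_transform_eventually[OF tendsto_const])
    qed
  qed simp
  have "((\<lambda>s. s powr (b - 1)) \<longlongrightarrow> 0) at_top"
    using b by (intro tendsto_neg_powr filterlim_ident) auto
  then have "(\<lambda>k. real k powr (b - 1)) \<longlonglongrightarrow> 0"
    by (rule filterlim_compose) (rule filterlim_real_sequentially)
  then have "(\<lambda>k. ennreal (1 + C * real k powr (b - 1))) \<longlonglongrightarrow> ennreal (1 + C * 0)"
    by (intro tendsto_intros)
  then have lim2: "(\<lambda>k. ennreal (1 + C * real k powr (b - 1))) \<longlonglongrightarrow> 1" by simp
  have "eventually (\<lambda>k. \<epsilon> < real k) sequentially"
    by (meson eventually_sequentiallyI le_less_trans less_le_trans of_nat_le_iff reals_Archimedean2)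
  then have "eventually (\<lambda>k. (\<integral>\<^sup>+t. ?\<kappa> t * indicator {..<real k} t \<partial>lborel) \<le> ennreal (1 + C * real k powr (b - 1))) sequentially"
    by eventually_elim (rule partial)
  with lim lim2 show ?thesis
    by (intro tendsto_le[OF sequentially_bot lim2 lim])
qed

section \<open>Riesz kernels\<close>

text \<open>The kernel of the Fourier multiplier \<open>\<bar>\<xi>\<bar> powr (- 2 * r)\<close> for \<open>0 < r\<close>; for \<open>- 1 < r < 0\<close> its
  absolute value away from the origin, which is the jump kernel of the multiplier.\<close>
definition riesz :: "real \<Rightarrow> 'a::euclidean_space \<Rightarrow> real" where
  "riesz r x = pi powr (2 * r - real DIM('a) / 2) * Gamma (real DIM('a) / 2 - r) / \<bar>Gamma r\<bar> * norm x powr (2 * r - real DIM('a))"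

lemma measurable_riesz [measurable]: "riesz r \<in> borel_measurable borel"
  unfolding riesz_def by measurable

text \<open>Substituting \<open>s = c / u\<close> turns the integral into Euler's integral for \<open>Gamma q\<close>.\<close>
lemma nn_integral_inverse_Gamma:
  assumes c: "0 < (c::real)" and q: "0 < q"
  shows "(\<integral>\<^sup>+s. ennreal (s powr (- q - 1) * exp (- (c / s))) * indicator {0<..} s \<partial>lborel) = ennreal (c powr (- q) * Gamma q)"
proof -
  let ?f = "\<lambda>s. s powr (- q - 1) * exp (- (c / s))"
  let ?h = "\<lambda>u. c powr (- q) * (u powr (q - 1) / exp u)"
  have "((\<lambda>t. t powr (q - 1) / exp t) has_integral Gamma q) {0<..}"
    using Gamma_integral_real[OF q]
    by (rule has_integral_spike_set_eq[THEN iffD1, rotated 2]) (auto intro: negligible_subset[of "{0}"])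
  then have h: "(?h has_integral c powr (- q) * Gamma q) {0<..}"
    by (rule has_integral_mult_right)
  then have abs: "?h absolutely_integrable_on {0<..}"
    by (intro nonnegative_absolutely_integrable_1) auto
  have eq: "\<bar>- (c / u\<^sup>2)\<bar> * ?f (c / u) = ?h u" if "u \<in> {0<..}" for u
  proof -
    have u: "0 < u" using that by simp
    have p: "(c / u) powr (- q - 1) = c powr (- q) / c * (u powr (q - 1) * u\<^sup>2)"
      using u c by (simp add: powr_divide powr_diff powr_minus_divide power2_eq_square)
    show ?thesis unfolding p using u c by (simp add: exp_minus field_simps)
  qed
  have "(\<lambda>u. \<bar>- (c / u\<^sup>2)\<bar> * ?f (c / u)) absolutely_integrable_on {0<..}"
    by (rule set_integrable_cong[THEN iffD1, OF refl refl _ abs]) (rule eq[symmetric])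
  moreover have "integral {0<..} (\<lambda>u. \<bar>- (c / u\<^sup>2)\<bar> * ?f (c / u)) = c powr (- q) * Gamma q"
    using eq by (intro integral_unique has_integral_eq[OF _ h]) (rule sym)
  ultimately have "(\<lambda>u. \<bar>- (c / u\<^sup>2)\<bar> * ?f (c / u)) absolutely_integrable_on {0<..}
      \<and> integral {0<..} (\<lambda>u. \<bar>- (c / u\<^sup>2)\<bar> * ?f (c / u)) = c powr (- q) * Gamma q" ..
  moreover have "((\<lambda>u. c / u) has_field_derivative - (c / u\<^sup>2)) (at u within {0<..})" if "u \<in> {0<..}" for u
    using that by (auto intro!: derivative_eq_intros simp: power2_eq_square)
  moreover have "inj_on (\<lambda>u. c / u) {0<..}"
    using c by (auto simp: inj_on_def)
  ultimately have "?f absolutely_integrable_on ((\<lambda>u. c / u) ` {0<..}) \<and> integral ((\<lambda>u. c / u) ` {0<..}) ?f = c powr (- q) * Gamma q"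
    by (subst (asm) has_absolute_integral_change_of_variables_1') auto
  moreover have "(\<lambda>u. c / u) ` {0<..} = {0<..}"
    using c by (auto simp: image_iff intro!: bexI[of _ "c / _"])
  ultimately have "(?f has_integral c powr (- q) * Gamma q) {0<..}"
    by (auto simp: has_integral_iff dest: set_lebesgue_integral_eq_integral(1))
  then show ?thesis
    by (rule nn_integral_has_integral_lebesgue'[rotated]) auto
qed

text \<open>Riesz kernels and jump kernels are mixtures with power weights, so the identities for
  \<open>weight\<close> carry over to them.  At the origin the mixture may be infinite, whereas
  \<open>riesz\<close> is real-valued.\<close>
lemma mixture_weight:
  fixes x :: "'a::euclidean_space"
  assumes x: "x \<noteq> 0" and r: "r < real DIM('a) / 2"
  shows "mixture (weight 0 r) x = ennreal (riesz r x)"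
proof -
  let ?n = "real DIM('a)"
  let ?c = "pi\<^sup>2 * (norm x)\<^sup>2" and ?q = "?n / 2 - r"
  have c: "0 < ?c" and q: "0 < ?q" using x r by auto
  have "weight 0 r s * ennreal (heat s x)
     = ennreal (pi powr (?n / 2) / \<bar>Gamma r\<bar>) * (ennreal (s powr (- ?q - 1) * exp (- (?c / s))) * indicator {0<..} s)" for s
  proof (cases "0 < s")
    case True
    have p: "s powr (- ?q - 1) = s powr (r - 1) / s powr (?n / 2)"
      by (simp add: powr_diff[symmetric] algebra_simps)
    have "s powr (r - 1) / \<bar>Gamma r\<bar> * ((pi / s) powr (?n / 2) * exp (- (?c / s)))
      = pi powr (?n / 2) / \<bar>Gamma r\<bar> * (s powr (- ?q - 1) * exp (- (?c / s)))"
      unfolding p using True by (simp add: powr_divide)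
    then show ?thesis
      using True by (simp add: weight_def heat_def ennreal_mult[symmetric])
  qed (simp add: weight_def)
  then have "mixture (weight 0 r) x = ennreal (pi powr (?n / 2) / \<bar>Gamma r\<bar>) * ennreal (?c powr (- ?q) * Gamma ?q)"
    unfolding mixture_def nn_integral_inverse_Gamma[OF c q, symmetric]
    by (subst nn_integral_cmult[symmetric], measurable)
  also have "\<dots> = ennreal (pi powr (?n / 2) / \<bar>Gamma r\<bar> * (?c powr (- ?q) * Gamma ?q))"
    using q by (intro ennreal_mult[symmetric]) (auto intro!: mult_nonneg_nonneg less_imp_le[OF Gamma_real_pos])
  also have "?c powr (- ?q) = (pi * norm x) powr (2 * (- ?q))"
    using x by (simp only: powr_powr[symmetric] powr_numeral power_mult_distrib) (simp add: powr_numeral power_mult_distrib)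
  also have "\<dots> = pi powr (2 * r - ?n) * norm x powr (2 * r - ?n)"
    by (simp add: powr_mult algebra_simps)
  also have "pi powr (?n / 2) / \<bar>Gamma r\<bar> * (pi powr (2 * r - ?n) * norm x powr (2 * r - ?n) * Gamma ?q) = riesz r x"
  proof -
    have "pi powr (2 * r - ?n / 2) = pi powr (?n / 2) * pi powr (2 * r - ?n)"
      by (simp add: powr_add[symmetric])
    then show ?thesis by (simp add: riesz_def)
  qed
  finally show ?thesis .
qed

lemma AE_mixture_weight:
  assumes r: "r < real DIM('a) / 2"
  shows "AE x in lborel. mixture (weight 0 r) (x::'a::euclidean_space) = ennreal (riesz r x)"
  using AE_lborel_singleton[of "0::'a"] by eventually_elim (rule mixture_weight[OF _ r])

lemma riesz_pos:
  assumes "x \<noteq> 0" "0 < r" "r < real DIM('a) / 2"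
  shows "0 < riesz r (x::'a::euclidean_space)"
  using assms unfolding riesz_def by (intro mult_pos_pos divide_pos_pos Gamma_real_pos) auto

lemma conv_mixture_weight:
  assumes "0 < c" "0 < d"
  shows "conv (mixture (weight 0 c)) (mixture (weight 0 d)) = (mixture (weight 0 (c + d)) :: 'a::euclidean_space \<Rightarrow> ennreal)"
  using assms by (intro ext) (simp add: conv_mixture weight_eq_0 conv_weight)

lemma C_const_pos: "0 \<le> \<gamma> \<Longrightarrow> \<gamma> < real n \<Longrightarrow> 0 < C_const n \<gamma>"
  unfolding C_const_def by (intro mult_pos_pos zero_less_power divide_pos_pos Gamma_real_pos) auto

text \<open>Up to constants, \<open>riesz ((n + \<gamma>) / 4)\<close> is \<open>norm x powr (- (n - \<gamma>) / 2)\<close>, the ground state for the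
  exponent \<open>\<gamma>\<close>.  Passing to \<open>riesz ((n - \<gamma>) / 4)\<close> amounts to applying the multiplier
  \<open>\<bar>\<xi>\<bar> powr \<gamma>\<close>, so this is the eigenvalue equation with the Hardy potential, and it is the
  origin of the constant \<open>C_const\<close>.\<close>
lemma riesz_quotient:
  fixes x :: "'a::euclidean_space"
  assumes x: "x \<noteq> 0" and \<gamma>: "0 \<le> \<gamma>" "\<gamma> < real DIM('a)"
  shows "riesz ((real DIM('a) - \<gamma>) / 4) x = norm x powr (- \<gamma>) / C_const DIM('a) \<gamma> * riesz ((real DIM('a) + \<gamma>) / 4) x"
proof -
  let ?n = "real DIM('a)"
  define G1 where "G1 = Gamma ((?n - \<gamma>) / 4)"
  define G2 where "G2 = Gamma ((?n + \<gamma>) / 4)"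
  have G: "0 < G1" "0 < G2" using \<gamma> by (auto intro!: Gamma_real_pos simp: G1_def G2_def)
  have e: "?n / 2 - (?n - \<gamma>) / 4 = (?n + \<gamma>) / 4" "?n / 2 - (?n + \<gamma>) / 4 = (?n - \<gamma>) / 4"
    by (simp_all add: field_simps)
  have p: "pi powr (2 * ((?n - \<gamma>) / 4) - ?n / 2) = pi powr (2 * ((?n + \<gamma>) / 4) - ?n / 2) / pi powr \<gamma>"
    by (simp add: powr_diff[symmetric] field_simps)
  have x: "norm x powr (2 * ((?n - \<gamma>) / 4) - ?n) = norm x powr (- \<gamma>) * norm x powr (2 * ((?n + \<gamma>) / 4) - ?n)"
    using x by (simp add: powr_add[symmetric] field_simps)
  show ?thesis
    unfolding riesz_def C_const_def e p x G1_def[symmetric] G2_def[symmetric]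
    using G by (simp add: field_simps power2_eq_square)
qed

section \<open>The Stein--Weiss inequality\<close>

text \<open>Schur's test with the test function \<open>norm y powr (- (n - \<beta>) / 2)\<close>, which is a multiple of a
  Riesz kernel.  Both applications of the kernel are then instances of the semigroup law of the
  Riesz kernels, which is why the constant is the quotient of the two sharp constants.\<close>
lemma stein_weiss:
  fixes w :: "'a::euclidean_space \<Rightarrow> ennreal"
  assumes [measurable]: "w \<in> borel_measurable borel"
    and \<beta>: "0 \<le> \<beta>" "\<beta> < \<alpha>" "\<alpha> < real DIM('a)"
  shows "(\<integral>\<^sup>+x. ennreal (norm x powr (- \<alpha>) / C_const DIM('a) \<alpha>) * (conv (mixture (weight 0 ((\<alpha> - \<beta>) / 4))) w x)\<^sup>2 \<partial>lborel)
    \<le> (\<integral>\<^sup>+x. ennreal (norm x powr (- \<beta>) / C_const DIM('a) \<beta>) * (w x)\<^sup>2 \<partial>lborel)"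
proof -
  let ?n = "real DIM('a)"
  let ?N = "\<lambda>r. mixture (weight 0 r) :: 'a \<Rightarrow> ennreal"
  define q where "q = (\<alpha> - \<beta>) / 4"
  define a where "a = (?n + \<beta>) / 4"
  have q: "0 < q" and a: "0 < a" "a < ?n / 2" using \<beta> by (auto simp: q_def a_def)
  define \<psi> where "\<psi> y = ennreal (riesz a y powr (1/2))" for y :: 'a
  define \<eta> where "\<eta> y = ennreal (riesz a y powr (- (1/2)))" for y :: 'a
  have [measurable]: "\<psi> \<in> borel_measurable borel" "\<eta> \<in> borel_measurable borel"
    unfolding \<psi>_def \<eta>_def by measurable
  have \<psi>\<eta>: "\<psi> y * \<eta> y = 1" "(\<psi> y)\<^sup>2 = ?N a y" "(\<eta> y)\<^sup>2 = ennreal (1 / riesz a y)" if "y \<noteq> 0" for y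
    using riesz_pos[OF that a] that a
    by (simp_all add: \<psi>_def \<eta>_def ennreal_mult[symmetric] ennreal_power powr_add[symmetric]
        powr_power mixture_weight powr_minus inverse_eq_divide power2_eq_square)
  define W where "W y = (\<eta> y * w y)\<^sup>2" for y
  have [measurable]: "W \<in> borel_measurable borel" unfolding W_def by measurable
  have schwarz: "(conv (?N q) w x)\<^sup>2 \<le> ?N (a + q) x * conv (?N q) W x" for x
  proof -
    let ?M = "density lborel (\<lambda>y. ?N q (x - y))"
    have ne: "AE y in lborel. (y::'a) \<noteq> 0" by (rule AE_lborel_singleton)
    have "\<psi> y * (\<eta> y * w y) = w y" if "y \<noteq> 0" for y
      by (simp add: mult.assoc[symmetric] \<psi>\<eta>(1)[OF that])
    then have "conv (?N q) w x = (\<integral>\<^sup>+y. \<psi> y * (\<eta> y * w y) \<partial>?M)"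
      unfolding conv_def using ne
      by (subst nn_integral_density) (auto intro!: nn_integral_cong_AE elim!: eventually_mono)
    also have "\<dots>\<^sup>2 \<le> (\<integral>\<^sup>+y. (\<psi> y)\<^sup>2 \<partial>?M) * (\<integral>\<^sup>+y. (\<eta> y * w y)\<^sup>2 \<partial>?M)"
      by (rule Cauchy_Schwarz_nn_integral) auto
    also have "(\<integral>\<^sup>+y. (\<psi> y)\<^sup>2 \<partial>?M) = conv (?N q) (?N a) x"
      unfolding conv_def using ne
      by (subst nn_integral_density) (auto intro!: nn_integral_cong_AE simp: \<psi>\<eta> elim!: eventually_mono)
    also have "\<dots> = ?N (a + q) x"
      using q a by (simp add: conv_mixture_weight add.commute)
    also have "(\<integral>\<^sup>+y. (\<eta> y * w y)\<^sup>2 \<partial>?M) = conv (?N q) W x"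
      unfolding conv_def W_def by (subst nn_integral_density) auto
    finally show ?thesis .
  qed
  have aq: "a + q = (?n + \<alpha>) / 4" and bq: "(?n - \<alpha>) / 4 + q = (?n - \<beta>) / 4" by (simp_all add: a_def q_def field_simps)
  have "(\<integral>\<^sup>+x. ennreal (norm x powr (- \<alpha>) / C_const DIM('a) \<alpha>) * (conv (?N q) w x)\<^sup>2 \<partial>lborel)
     \<le> (\<integral>\<^sup>+x. ?N ((?n - \<alpha>) / 4) x * conv (?N q) W x \<partial>lborel)"
  proof (intro nn_integral_mono_AE eventually_mono[OF AE_lborel_singleton[of "0::'a"]])
    fix x :: 'a assume x: "x \<noteq> 0"
    have "ennreal (norm x powr (- \<alpha>) / C_const DIM('a) \<alpha>) * ?N (a + q) x = ?N ((?n - \<alpha>) / 4) x"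
      using x \<beta> C_const_pos[of \<alpha> "DIM('a)"] unfolding aq
      by (subst (1 2) mixture_weight) (auto simp: ennreal_mult'[symmetric] riesz_quotient)
    moreover have "ennreal (norm x powr (- \<alpha>) / C_const DIM('a) \<alpha>) * (conv (?N q) w x)\<^sup>2
      \<le> ennreal (norm x powr (- \<alpha>) / C_const DIM('a) \<alpha>) * (?N (a + q) x * conv (?N q) W x)"
      by (intro mult_left_mono schwarz) simp
    ultimately show "ennreal (norm x powr (- \<alpha>) / C_const DIM('a) \<alpha>) * (conv (?N q) w x)\<^sup>2 \<le> ?N ((?n - \<alpha>) / 4) x * conv (?N q) W x"
      by (simp add: mult.assoc[symmetric])
  qed
  also have "\<dots> = (\<integral>\<^sup>+x. conv (?N q) (?N ((?n - \<alpha>) / 4)) x * W x \<partial>lborel)"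
    by (rule conv_adjoint[symmetric]) auto
  also have "\<dots> = (\<integral>\<^sup>+x. ?N ((?n - \<beta>) / 4) x * W x \<partial>lborel)"
    using q \<beta> by (simp add: conv_mixture_weight add.commute[of q] bq)
  also have "\<dots> = (\<integral>\<^sup>+x. ennreal (norm x powr (- \<beta>) / C_const DIM('a) \<beta>) * (w x)\<^sup>2 \<partial>lborel)"
  proof (intro nn_integral_cong_AE eventually_mono[OF AE_lborel_singleton[of "0::'a"]])
    fix x :: 'a assume x: "x \<noteq> 0"
    have "?N ((?n - \<beta>) / 4) x * ennreal (1 / riesz a x) = ennreal (norm x powr (- \<beta>) / C_const DIM('a) \<beta>)"
      using x \<beta> C_const_pos[of \<beta> "DIM('a)"] riesz_pos[OF x a]
      by (subst mixture_weight) (auto simp: ennreal_mult'[symmetric] riesz_quotient a_def)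
    then show "?N ((?n - \<beta>) / 4) x * W x = ennreal (norm x powr (- \<beta>) / C_const DIM('a) \<beta>) * (w x)\<^sup>2"
      by (simp add: W_def power_mult_distrib \<psi>\<eta>[OF x] mult.assoc[symmetric])
  qed
  finally show ?thesis by (simp add: q_def)
qed

text \<open>The Gaussian has finite Riesz energy; it serves as a dominating function in truncations.
  By the semigroup law its potential is an integral over \<open>s\<close> of \<open>heat (s + 1)\<close>, which is bounded by a
  constant for \<open>s < 1\<close> and by a multiple of \<open>heat s e\<close> with a unit vector \<open>e\<close> for \<open>1 \<le> s\<close>; both bounds are
  integrable against the weight.\<close>
lemma conv_riesz_heat_finite:
  assumes b: "0 < b" "b < real DIM('a) / 2"
  shows "(\<integral>\<^sup>+x. conv (mixture (weight 0 (b / 2))) (\<lambda>x. ennreal (heat 1 x)) x * conv (mixture (weight 0 (b / 2))) (\<lambda>x. ennreal (heat 1 x)) (x::'a::euclidean_space) \<partial>lborel) < top"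
proof -
  let ?n = "real DIM('a)"
  let ?N = "\<lambda>r. mixture (weight 0 r) :: 'a \<Rightarrow> ennreal"
  let ?h = "\<lambda>x::'a. ennreal (heat 1 x)"
  obtain e :: 'a where e: "norm e = 1" using vector_choose_size[of 1] by auto
  define K where "K = ennreal (pi powr (?n / 2)) * conv (weight 0 1) (weight 0 b) 1 + ennreal (exp (pi\<^sup>2)) * ?N b e"
  have heat_le: "ennreal (heat (s + 1) x) \<le> ennreal (pi powr (?n / 2)) * weight 0 1 (1 - s) + ennreal (exp (pi\<^sup>2)) * ennreal (heat s e)"
    if s: "0 < s" for s and x :: 'a
  proof -
    have "heat (s + 1) x \<le> (pi / (s + 1)) powr (?n / 2)"
      unfolding heat_def using s by (intro mult_left_le) auto
    also have "\<dots> \<le> pi powr (?n / 2) * indicator {..<1} s + exp (pi\<^sup>2) * heat s e"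
    proof (cases "s < 1")
      case True
      have "(pi / (s + 1)) powr (?n / 2) \<le> pi powr (?n / 2)"
        using s by (intro powr_mono2) (auto simp: field_simps)
      then show ?thesis using True by (simp add: add_increasing2)
    next
      case False
      have "(pi / (s + 1)) powr (?n / 2) \<le> (pi / s) powr (?n / 2)"
        using s by (intro powr_mono2) (auto simp: field_simps)
      also have "\<dots> \<le> (pi / s) powr (?n / 2) * exp (pi\<^sup>2 - pi\<^sup>2 / s)"
        using s False mult_left_mono[of 1 "exp (pi\<^sup>2 - pi\<^sup>2 / s)" "(pi / s) powr (?n / 2)"]
        by (simp add: field_simps)
      also have "\<dots> = exp (pi\<^sup>2) * heat s e"
        by (simp add: heat_def e exp_diff exp_minus field_simps)
      finally show ?thesis using False by simp
    qed
    finally have "ennreal (heat (s + 1) x) \<le> ennreal (pi powr (?n / 2) * indicator {..<1} s + exp (pi\<^sup>2) * heat s e)"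
      by (rule ennreal_leI)
    also have "\<dots> = ennreal (pi powr (?n / 2)) * weight 0 1 (1 - s) + ennreal (exp (pi\<^sup>2)) * ennreal (heat s e)"
      by (subst ennreal_plus) (auto simp: ennreal_mult weight_def indicator_def)
    finally show ?thesis .
  qed
  have K: "conv (?N b) ?h x \<le> K" for x
  proof -
    have "conv (?N b) ?h x = (\<integral>\<^sup>+y. (\<integral>\<^sup>+s. weight 0 b s * ennreal (heat s (x - y)) * ?h y \<partial>lborel) \<partial>lborel)"
      unfolding conv_def mixture_def by (simp add: nn_integral_multc)
    also have "\<dots> = (\<integral>\<^sup>+s. (\<integral>\<^sup>+y. weight 0 b s * ennreal (heat s (x - y)) * ?h y \<partial>lborel) \<partial>lborel)"
      by (rule lborel_pair.Fubini') measurable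
    also have "\<dots> \<le> (\<integral>\<^sup>+s. ennreal (pi powr (?n / 2)) * (weight 0 1 (1 - s) * weight 0 b s) + ennreal (exp (pi\<^sup>2)) * (weight 0 b s * ennreal (heat s e)) \<partial>lborel)"
    proof (rule nn_integral_mono)
      fix s
      show "(\<integral>\<^sup>+y. weight 0 b s * ennreal (heat s (x - y)) * ?h y \<partial>lborel)
         \<le> ennreal (pi powr (?n / 2)) * (weight 0 1 (1 - s) * weight 0 b s) + ennreal (exp (pi\<^sup>2)) * (weight 0 b s * ennreal (heat s e))"
      proof (cases "0 < s")
        case True
        have "(\<integral>\<^sup>+y. weight 0 b s * ennreal (heat s (x - y)) * ?h y \<partial>lborel) = weight 0 b s * ennreal (heat (s + 1) x)"
          using True by (simp add: mult.assoc nn_integral_cmult heat_semigroup)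
        also have "\<dots> \<le> weight 0 b s * (ennreal (pi powr (?n / 2)) * weight 0 1 (1 - s) + ennreal (exp (pi\<^sup>2)) * ennreal (heat s e))"
          by (intro mult_left_mono heat_le True) simp
        finally show ?thesis by (simp add: distrib_left mult_ac)
      qed (simp add: weight_eq_0)
    qed
    also have "\<dots> = K"
      unfolding K_def conv_def mixture_def by (simp add: nn_integral_add nn_integral_cmult)
    finally show ?thesis .
  qed
  have "K < top"
    using b e unfolding K_def
    by (subst mixture_weight) (auto simp: conv_weight weight_def ennreal_mult_eq_top_iff less_top[symmetric])
  have "(\<integral>\<^sup>+x. conv (?N (b / 2)) ?h x * conv (?N (b / 2)) ?h x \<partial>lborel) = (\<integral>\<^sup>+x. ?h x * conv (?N (b / 2)) (conv (?N (b / 2)) ?h) x \<partial>lborel)"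
    by (rule conv_adjoint) auto
  also have "conv (?N (b / 2)) (conv (?N (b / 2)) ?h) = conv (?N b) ?h"
    using b by (subst conv_assoc[symmetric]) (auto simp: conv_mixture_weight)
  also have "(\<integral>\<^sup>+x. ?h x * conv (?N b) ?h x \<partial>lborel) \<le> (\<integral>\<^sup>+x. K * ?h x \<partial>lborel)"
    by (intro nn_integral_mono, subst mult.commute, intro mult_right_mono K) simp
  also have "\<dots> = K"
    by (simp add: nn_integral_cmult nn_integral_heat)
  finally show ?thesis using \<open>K < top\<close> by simp
qed

section \<open>The ground state inequality for a truncated jump kernel\<close>

lemma nn_integral_conv_mass:
  fixes K :: "'a::euclidean_space \<Rightarrow> ennreal"
  assumes [measurable]: "K \<in> borel_measurable borel" "F \<in> borel_measurable borel"
  shows "(\<integral>\<^sup>+x. (\<integral>\<^sup>+y. K (x - y) * F x \<partial>lborel) \<partial>lborel) = (\<integral>\<^sup>+x. K x \<partial>lborel) * (\<integral>\<^sup>+x. F x \<partial>lborel)"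
proof -
  have "(\<integral>\<^sup>+y. K (x - y) * F x \<partial>lborel) = (\<integral>\<^sup>+x. K x \<partial>lborel) * F x" for x
    by (simp add: nn_integral_multc nn_integral_reflect)
  then show ?thesis by (simp add: nn_integral_cmult)
qed

lemma nn_integral_swap_even:
  fixes K :: "'a::euclidean_space \<Rightarrow> ennreal"
  assumes [measurable]: "K \<in> borel_measurable borel" "(\<lambda>(x, y). F x y) \<in> borel_measurable (borel \<Otimes>\<^sub>M borel)"
    and even: "\<And>x. K (- x) = K x"
  shows "(\<integral>\<^sup>+x. (\<integral>\<^sup>+y. K (x - y) * F y x \<partial>lborel) \<partial>lborel) = (\<integral>\<^sup>+x. (\<integral>\<^sup>+y. K (x - y) * F x y \<partial>lborel) \<partial>lborel)"
proof -
  have K: "K (x - y) = K (y - x)" for x y using even[of "x - y"] by simp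
  have "(\<integral>\<^sup>+x. (\<integral>\<^sup>+y. K (x - y) * F y x \<partial>lborel) \<partial>lborel) = (\<integral>\<^sup>+y. (\<integral>\<^sup>+x. K (x - y) * F y x \<partial>lborel) \<partial>lborel)"
    by (rule lborel_pair.Fubini') measurable
  then show ?thesis by (subst (asm) (2) K) simp
qed

text \<open>The truncated quadratic form evaluated on two Riesz potentials: since \<open>approx_delta\<close> is what
  remains of \<open>weight 0 b\<close> after applying the truncated operator, the difference is the form with
  kernel \<open>mixture (approx_delta \<epsilon> b)\<close> evaluated on the densities.\<close>
lemma truncated_energy:
  fixes u v :: "'a::euclidean_space \<Rightarrow> ennreal"
  assumes [measurable]: "u \<in> borel_measurable borel" "v \<in> borel_measurable borel"
    and b: "0 < b" "b < 1" and \<epsilon>: "0 < \<epsilon>"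
  defines "N \<equiv> mixture (weight 0 (b / 2)) :: 'a \<Rightarrow> ennreal"
  shows "ennreal (\<epsilon> powr (- b) / Gamma (1 - b)) * (\<integral>\<^sup>+x. conv N u x * conv N v x \<partial>lborel)
    = (\<integral>\<^sup>+x. conv N u x * conv (mixture (weight \<epsilon> (- b))) (conv N v) x \<partial>lborel)
      + (\<integral>\<^sup>+x. u x * conv (mixture (approx_delta \<epsilon> b)) v x \<partial>lborel)"
proof -
  let ?m = "ennreal (\<epsilon> powr (- b) / Gamma (1 - b))"
  let ?k = "mixture (weight \<epsilon> (- b)) :: 'a \<Rightarrow> ennreal"
  let ?\<kappa> = "mixture (approx_delta \<epsilon> b) :: 'a \<Rightarrow> ennreal"
  let ?Nb = "mixture (weight 0 b) :: 'a \<Rightarrow> ennreal"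
  have [measurable]: "N \<in> borel_measurable borel" unfolding N_def by measurable
  have even: "N (- x) = N x" for x by (simp add: N_def)
  have NN: "conv N N = ?Nb" unfolding N_def using b by (simp add: conv_mixture_weight)
  have k: "conv ?k ?Nb x + ?\<kappa> x = ?m * ?Nb x" for x
  proof -
    have "conv ?k ?Nb x = mixture (conv (weight \<epsilon> (- b)) (weight 0 b)) x"
      using \<epsilon> by (intro conv_mixture) (auto simp: weight_eq_0)
    then have "conv ?k ?Nb x + ?\<kappa> x = mixture (\<lambda>s. conv (weight \<epsilon> (- b)) (weight 0 b) s + approx_delta \<epsilon> b s) x"
      by (simp add: mixture_add)
    then show ?thesis by (simp add: approx_delta_add[OF b \<epsilon>] mixture_cmult)
  qed
  have *: "conv N (conv N v) = conv ?Nb v"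
    by (simp add: conv_assoc[symmetric] NN)
  have "conv N (conv ?k (conv N v)) = conv (conv ?k ?Nb) v"
  proof -
    have "conv N (conv ?k (conv N v)) = conv (conv N ?k) (conv N v)"
      by (rule conv_assoc[symmetric]) measurable
    also have "conv N ?k = conv ?k N"
      by (rule conv_commute) measurable
    also have "conv (conv ?k N) (conv N v) = conv ?k (conv N (conv N v))"
      by (rule conv_assoc) measurable
    also have "\<dots> = conv (conv ?k ?Nb) v"
      unfolding * by (rule conv_assoc[symmetric]) measurable
    finally show ?thesis .
  qed
  then have "(\<integral>\<^sup>+x. conv N u x * conv ?k (conv N v) x \<partial>lborel) = (\<integral>\<^sup>+x. u x * conv (conv ?k ?Nb) v x \<partial>lborel)"
    by (subst conv_adjoint[where F=N]) (auto simp: even)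
  then have "(\<integral>\<^sup>+x. conv N u x * conv ?k (conv N v) x \<partial>lborel) + (\<integral>\<^sup>+x. u x * conv ?\<kappa> v x \<partial>lborel)
     = (\<integral>\<^sup>+x. u x * (conv v (conv ?k ?Nb) x + conv v ?\<kappa> x) \<partial>lborel)"
    by (simp add: nn_integral_add[symmetric] distrib_left conv_commute[of _ v])
  also have "\<dots> = (\<integral>\<^sup>+x. u x * conv v (\<lambda>x. ?m * ?Nb x) x \<partial>lborel)"
    by (subst conv_add_right[symmetric]) (simp_all add: k)
  also have "\<dots> = (\<integral>\<^sup>+x. ?m * (u x * conv ?Nb v x) \<partial>lborel)"
  proof (rule nn_integral_cong)
    fix x
    have "conv v (\<lambda>x. ?m * ?Nb x) x = ?m * conv ?Nb v x"
      by (subst conv_cmult_right) (simp_all add: conv_commute[of v ?Nb])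
    then show "u x * conv v (\<lambda>x. ?m * ?Nb x) x = ?m * (u x * conv ?Nb v x)"
      by (simp add: mult.left_commute)
  qed
  also have "\<dots> = ?m * (\<integral>\<^sup>+x. u x * conv N (conv N v) x \<partial>lborel)"
    by (simp add: nn_integral_cmult *)
  also have "(\<integral>\<^sup>+x. u x * conv N (conv N v) x \<partial>lborel) = (\<integral>\<^sup>+x. conv N u x * conv N v x \<partial>lborel)"
    by (rule conv_adjoint[symmetric]) (auto simp: even)
  finally show ?thesis by simp
qed

text \<open>The arithmetic of the ground state argument.  \<open>D\<close> is the ground state form, \<open>Y\<close> the Hardy
  term and \<open>F\<close> the norm of \<open>f\<close>; \<open>I\<close> and \<open>A\<close> are bilinear forms in the potentials of the two
  parts of \<open>f\<close>, \<open>Q\<close> is one in the parts themselves, and \<open>B\<close> is the integral of \<open>g\<^sup>2 / \<omega>\<close> against the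
  convolution of the jump kernel with \<open>\<omega>\<close>.  When the hypotheses are added, all terms other than
  \<open>D\<close>, \<open>Y\<close> and \<open>F\<close> occur on both sides, and they are finite.\<close>
lemma ennreal_cancel_combine:
  fixes D Y B F Auu Avv Auv Quu Qvv Quv Iuu Ivv Iuv Ig m :: ennreal
  assumes "D + 2 * Auu + 2 * Avv = 2 * B + 4 * Auv"
    and "B + Y \<le> m * Ig"
    and "Ig + 2 * Iuv = Iuu + Ivv"
    and "m * Iuu = Auu + Quu" "m * Ivv = Avv + Qvv" "m * Iuv = Auv + Quv"
    and "Quu + Qvv \<le> F + 2 * Quv"
    and fin: "m < top" "Iuu < top" "Ivv < top"
  shows "D + 2 * Y \<le> 2 * F"
proof -
  let ?Z = "2 * Auu + 2 * Avv + 4 * (m * Iuv)"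
  have "2 * Iuv \<le> Iuu + Ivv"
    unfolding assms(3)[symmetric] by (rule add_increasing) simp_all
  then have "2 * Iuv < top"
    using fin by (auto intro: le_less_trans)
  then have "m * Iuv < top"
    using fin(1) by (auto simp: ennreal_mult_less_top)
  moreover have "Auu \<le> m * Iuu" "Avv \<le> m * Ivv"
    unfolding assms(4,5) by simp_all
  moreover have "m * Iuu < top" "m * Ivv < top"
    using fin by (simp_all add: ennreal_mult_less_top)
  ultimately have "Auu < top" "Avv < top" "m * Iuv < top"
    by (blast intro: le_less_trans)+
  then have "2 * Auu < top" "2 * Avv < top" "4 * (m * Iuv) < top"
    by (simp_all add: ennreal_mult_less_top)
  then have "?Z < top"
    unfolding ennreal_add_less_top by blast
  then have Z: "?Z \<noteq> top"
    by (rule less_imp_neq)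
  have "?Z + (D + 2 * Y) = (D + 2 * Auu + 2 * Avv) + 2 * Y + 4 * (m * Iuv)"
    by (simp add: ac_simps)
  also have "\<dots> = 2 * (B + Y) + 4 * Auv + 4 * (m * Iuv)"
    unfolding assms(1) by (simp add: distrib_left ac_simps)
  also have "\<dots> \<le> 2 * (m * Ig) + 4 * Auv + 4 * (m * Iuv)"
    by (intro add_right_mono mult_left_mono assms(2)) simp
  also have "\<dots> = 2 * (m * (Ig + 2 * Iuv)) + 4 * Auv"
    by (simp add: distrib_left ac_simps)
  also have "\<dots> = 2 * (Auu + Avv) + 4 * Auv + 2 * (Quu + Qvv)"
    unfolding assms(3) distrib_left assms(4,5) by (simp add: ac_simps)
  also have "\<dots> \<le> 2 * (Auu + Avv) + 4 * Auv + 2 * (F + 2 * Quv)"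
    by (intro add_left_mono mult_left_mono assms(7)) simp
  also have "\<dots> = ?Z + 2 * F"
    unfolding assms(6) by (simp add: distrib_left ac_simps)
  finally show ?thesis using Z by (simp add: ennreal_add_left_cancel_le)
qed

text \<open>With \<open>g = U - V\<close>, the difference between the truncated form at \<open>g\<close> and the ground state form at
  \<open>g / \<omega>\<close> is the integral of \<open>g\<^sup>2 / \<omega>\<close> against the truncated operator applied to \<open>\<omega>\<close>, which
  \<open>levy_supersolution\<close> bounds from below.  The truncated form itself is at most the squared norm of
  \<open>f\<close>, because by \<open>truncated_energy\<close> it is the average of \<open>f x * f y\<close> over a kernel of mass at most
  \<open>1\<close>.  Finiteness of the energies of \<open>U\<close> and \<open>V\<close> is what permits the cancellation.\<close>
lemma ground_state_truncated:
  fixes f U V :: "'a::euclidean_space \<Rightarrow> real"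
  assumes [measurable]: "f \<in> borel_measurable borel" "U \<in> borel_measurable borel" "V \<in> borel_measurable borel"
    and b: "0 < b" "b < 1" "b < real DIM('a) / 2" and \<epsilon>: "0 < \<epsilon>"
    and U: "AE x in lborel. conv (mixture (weight 0 (b / 2))) (\<lambda>x. ennreal (f x)) x = ennreal (U x)"
    and V: "AE x in lborel. conv (mixture (weight 0 (b / 2))) (\<lambda>x. ennreal (- f x)) x = ennreal (V x)"
    and nonneg: "\<And>x. 0 \<le> U x" "\<And>x. 0 \<le> V x"
    and finU: "(\<integral>\<^sup>+x. ennreal (U x * U x) \<partial>lborel) < top"
    and finV: "(\<integral>\<^sup>+x. ennreal (V x * V x) \<partial>lborel) < top"
  defines "a \<equiv> (real DIM('a) / 2 + b) / 2"
  shows "(\<integral>\<^sup>+x. (\<integral>\<^sup>+y. mixture (weight \<epsilon> (- b)) (x - y) *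
            ennreal (((U x - V x) / riesz a x - (U y - V y) / riesz a y)\<^sup>2 * riesz a x * riesz a y) \<partial>lborel) \<partial>lborel)
      + 2 * (\<integral>\<^sup>+x. mixture (hardy_weight \<epsilon> b a) x * ennreal ((U x - V x)\<^sup>2 / riesz a x) \<partial>lborel)
    \<le> 2 * (\<integral>\<^sup>+x. ennreal ((f x)\<^sup>2) \<partial>lborel)"
proof -
  let ?k = "mixture (weight \<epsilon> (- b)) :: 'a \<Rightarrow> ennreal"
  let ?\<kappa> = "mixture (approx_delta \<epsilon> b) :: 'a \<Rightarrow> ennreal"
  let ?m = "ennreal (\<epsilon> powr (- b) / Gamma (1 - b))"
  let ?N = "mixture (weight 0 (b / 2)) :: 'a \<Rightarrow> ennreal"
  let ?u = "\<lambda>x. ennreal (f x)" and ?v = "\<lambda>x. ennreal (- f x)"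
  let ?\<omega> = "riesz a :: 'a \<Rightarrow> real"
  define g where "g x = U x - V x" for x
  have [measurable]: "g \<in> borel_measurable borel" unfolding g_def by measurable
  have a: "0 < a" "a < real DIM('a) / 2" "b < a" using b by (auto simp: a_def)
  have ne: "AE x in lborel. (x::'a) \<noteq> 0" by (rule AE_lborel_singleton)
  have \<omega>: "0 < ?\<omega> x" if "x \<noteq> 0" for x using riesz_pos[OF that a(1,2)] .

  define A where "A F G = (\<integral>\<^sup>+x. (\<integral>\<^sup>+y. ?k (x - y) * ennreal (F x * G y) \<partial>lborel) \<partial>lborel)" for F G :: "'a \<Rightarrow> real"
  define B where "B = (\<integral>\<^sup>+x. (\<integral>\<^sup>+y. ?k (x - y) * ennreal ((g x)\<^sup>2 / ?\<omega> x * ?\<omega> y) \<partial>lborel) \<partial>lborel)"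
  define D where "D = (\<integral>\<^sup>+x. (\<integral>\<^sup>+y. ?k (x - y) * ennreal ((g x / ?\<omega> x - g y / ?\<omega> y)\<^sup>2 * ?\<omega> x * ?\<omega> y) \<partial>lborel) \<partial>lborel)"
  define Y where "Y = (\<integral>\<^sup>+x. mixture (hardy_weight \<epsilon> b a) x * ennreal ((g x)\<^sup>2 / ?\<omega> x) \<partial>lborel)"
  define I where "I F G = (\<integral>\<^sup>+x. ennreal (F x * G x) \<partial>lborel)" for F G :: "'a \<Rightarrow> real"
  define Q where "Q p q = (\<integral>\<^sup>+x. (\<integral>\<^sup>+y. ?\<kappa> (x - y) * (p x * q y) \<partial>lborel) \<partial>lborel)" for p q :: "'a \<Rightarrow> ennreal"

  have A_conv: "A F G = (\<integral>\<^sup>+x. ennreal (F x) * conv ?k (\<lambda>y. ennreal (G y)) x \<partial>lborel)"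
    if [measurable]: "F \<in> borel_measurable borel" "G \<in> borel_measurable borel" and "\<And>x. 0 \<le> F x" "\<And>x. 0 \<le> G x" for F G
    unfolding A_def conv_def
    by (intro nn_integral_cong, subst nn_integral_cmult[symmetric]) (auto simp: ennreal_mult that mult_ac)
  have Q_conv: "Q p q = (\<integral>\<^sup>+x. p x * conv ?\<kappa> q x \<partial>lborel)"
    if [measurable]: "p \<in> borel_measurable borel" "q \<in> borel_measurable borel" for p q
    unfolding Q_def conv_def
    by (intro nn_integral_cong, subst nn_integral_cmult[symmetric]) (auto simp: mult_ac)

  have energy: "?m * I F G = A F G + Q p q"
    if F: "AE x in lborel. conv ?N p x = ennreal (F x)" and G: "AE x in lborel. conv ?N q x = ennreal (G x)"
      and [measurable]: "F \<in> borel_measurable borel" "G \<in> borel_measurable borel" "p \<in> borel_measurable borel" "q \<in> borel_measurable borel"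
      and nn: "\<And>x. 0 \<le> F x" "\<And>x. 0 \<le> G x" for F G p q
  proof -
    have "I F G = (\<integral>\<^sup>+x. conv ?N p x * conv ?N q x \<partial>lborel)"
      unfolding I_def using F G by (intro nn_integral_cong_AE, eventually_elim) (simp add: ennreal_mult nn)
    moreover have "A F G = (\<integral>\<^sup>+x. conv ?N p x * conv ?k (conv ?N q) x \<partial>lborel)"
    proof -
      have "conv ?k (conv ?N q) = conv ?k (\<lambda>y. ennreal (G y))" by (rule conv_cong_AE[OF G])
      then show ?thesis
        unfolding A_conv[OF that(3,4) nn] by (intro nn_integral_cong_AE eventually_mono[OF F]) simp
    qed
    ultimately show ?thesis
      using truncated_energy[of p q b \<epsilon>] b \<epsilon> by (simp add: Q_conv)
  qed
  have E: "?m * I U U = A U U + Q ?u ?u" "?m * I V V = A V V + Q ?v ?v" "?m * I U V = A U V + Q ?u ?v"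
    using U V by (auto intro!: energy simp: nonneg)

  have Ig: "I g g + 2 * I U V = I U U + I V V"
  proof -
    have "I g g + 2 * I U V = (\<integral>\<^sup>+x. ennreal (g x * g x) + 2 * ennreal (U x * V x) \<partial>lborel)"
      unfolding I_def by (simp add: nn_integral_add nn_integral_cmult)
    also have "\<dots> = (\<integral>\<^sup>+x. ennreal (U x * U x) + ennreal (V x * V x) \<partial>lborel)"
    proof (rule nn_integral_cong)
      fix x
      have "ennreal (g x * g x) + 2 * ennreal (U x * V x) = ennreal (g x * g x + 2 * (U x * V x))"
        using nonneg by (simp add: ennreal_mult' ennreal_plus)
      also have "g x * g x + 2 * (U x * V x) = U x * U x + V x * V x"
        by (simp add: g_def algebra_simps)
      finally show "ennreal (g x * g x) + 2 * ennreal (U x * V x) = ennreal (U x * U x) + ennreal (V x * V x)"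
        using nonneg by simp
    qed
    finally show ?thesis unfolding I_def by (simp add: nn_integral_add)
  qed

  \<comment> \<open>The truncated operator at the ground state dominates the Hardy term.\<close>
  have hardy: "B + Y \<le> ?m * I g g"
  proof -
    have \<omega>N: "AE x in lborel. ennreal (?\<omega> x) = mixture (weight 0 a) x"
      using AE_mixture_weight[OF a(2)] by eventually_elim simp
    have "B = (\<integral>\<^sup>+x. ennreal ((g x)\<^sup>2 / ?\<omega> x) * conv ?k (\<lambda>y. ennreal (?\<omega> y)) x \<partial>lborel)"
      unfolding B_def conv_def
    proof (intro nn_integral_cong_AE eventually_mono[OF ne])
      fix x :: 'a assume x: "x \<noteq> 0"
      show "(\<integral>\<^sup>+y. ?k (x - y) * ennreal ((g x)\<^sup>2 / ?\<omega> x * ?\<omega> y) \<partial>lborel)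
          = ennreal ((g x)\<^sup>2 / ?\<omega> x) * (\<integral>\<^sup>+y. ?k (x - y) * ennreal (?\<omega> y) \<partial>lborel)"
      proof -
        have "ennreal ((g x)\<^sup>2 / ?\<omega> x * ?\<omega> y) = ennreal ((g x)\<^sup>2 / ?\<omega> x) * ennreal (?\<omega> y)" for y
          using \<omega>[OF x] by (intro ennreal_mult') simp
        then show ?thesis
          by (subst nn_integral_cmult[symmetric]) (auto simp: mult_ac)
      qed
    qed
    also have "conv ?k (\<lambda>y. ennreal (?\<omega> y)) = conv ?k (mixture (weight 0 a))"
      by (rule conv_cong_AE[OF \<omega>N])
    finally have "B + Y = (\<integral>\<^sup>+x. ennreal ((g x)\<^sup>2 / ?\<omega> x) * (conv ?k (mixture (weight 0 a)) x + mixture (hardy_weight \<epsilon> b a) x) \<partial>lborel)"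
      unfolding Y_def by (simp add: nn_integral_add[symmetric] distrib_left mult.commute)
    also have "\<dots> \<le> (\<integral>\<^sup>+x. ?m * ennreal (g x * g x) \<partial>lborel)"
    proof (intro nn_integral_mono_AE eventually_mono[OF eventually_conj[OF ne \<omega>N]])
      fix x :: 'a assume x: "x \<noteq> 0 \<and> ennreal (?\<omega> x) = mixture (weight 0 a) x"
      have "conv ?k (mixture (weight 0 a)) x + mixture (hardy_weight \<epsilon> b a) x
          = mixture (\<lambda>s. conv (weight \<epsilon> (- b)) (weight 0 a) s + hardy_weight \<epsilon> b a s) x"
        using \<epsilon> by (subst conv_mixture) (auto simp: weight_eq_0 mixture_add)
      also have "\<dots> \<le> mixture (\<lambda>s. ?m * weight 0 a s) x"
        using b a by (intro mixture_mono levy_supersolution \<epsilon>) auto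
      also have "\<dots> = ?m * ennreal (?\<omega> x)" using x by (simp add: mixture_cmult)
      finally have "ennreal ((g x)\<^sup>2 / ?\<omega> x) * (conv ?k (mixture (weight 0 a)) x + mixture (hardy_weight \<epsilon> b a) x)
        \<le> ennreal ((g x)\<^sup>2 / ?\<omega> x) * (?m * ennreal (?\<omega> x))"
        by (intro mult_left_mono) auto
      also have "\<dots> = ?m * ennreal ((g x)\<^sup>2 / ?\<omega> x * ?\<omega> x)"
      proof -
        have "ennreal ((g x)\<^sup>2 / ?\<omega> x * ?\<omega> x) = ennreal ((g x)\<^sup>2 / ?\<omega> x) * ennreal (?\<omega> x)"
          using \<omega>[of x] x by (intro ennreal_mult) auto
        then show ?thesis by (simp only: mult.left_commute)
      qed
      also have "(g x)\<^sup>2 / ?\<omega> x * ?\<omega> x = g x * g x"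
        using \<omega>[of x] x by (simp add: power2_eq_square)
      finally show "ennreal ((g x)\<^sup>2 / ?\<omega> x) * (conv ?k (mixture (weight 0 a)) x + mixture (hardy_weight \<epsilon> b a) x)
        \<le> ?m * ennreal (g x * g x)" .
    qed
    also have "\<dots> = ?m * I g g" by (simp add: I_def nn_integral_cmult)
    finally show ?thesis .
  qed

  \<comment> \<open>The ground state representation, with the negative terms moved to the other side.\<close>
  have form: "D + 2 * A U U + 2 * A V V = 2 * B + 4 * A U V"
  proof -
    have AVU: "A V U = A U V"
      unfolding A_def using nn_integral_swap_even[of ?k "\<lambda>x y. ennreal (U x * V y)"]
      by (simp add: mult.commute)
    define B' where "B' = (\<integral>\<^sup>+x. (\<integral>\<^sup>+y. ?k (x - y) * ennreal ((g y)\<^sup>2 / ?\<omega> y * ?\<omega> x) \<partial>lborel) \<partial>lborel)"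
    have B': "B' = B"
      unfolding B_def B'_def using nn_integral_swap_even[of ?k "\<lambda>x y. ennreal ((g x)\<^sup>2 / ?\<omega> x * ?\<omega> y)"] by simp
    have "D + 2 * A U U + 2 * A V V = (\<integral>\<^sup>+x. (\<integral>\<^sup>+y. ?k (x - y) * ennreal ((g x / ?\<omega> x - g y / ?\<omega> y)\<^sup>2 * ?\<omega> x * ?\<omega> y)
        + 2 * (?k (x - y) * ennreal (U x * U y)) + 2 * (?k (x - y) * ennreal (V x * V y)) \<partial>lborel) \<partial>lborel)"
      unfolding D_def A_def by (simp add: nn_integral_add nn_integral_cmult)
    also have "\<dots> = (\<integral>\<^sup>+x. (\<integral>\<^sup>+y. (?k (x - y) * ennreal ((g x)\<^sup>2 / ?\<omega> x * ?\<omega> y) + ?k (x - y) * ennreal ((g y)\<^sup>2 / ?\<omega> y * ?\<omega> x))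
        + 2 * (?k (x - y) * ennreal (U x * V y)) + 2 * (?k (x - y) * ennreal (V x * U y)) \<partial>lborel) \<partial>lborel)"
    proof (intro nn_integral_cong_AE eventually_mono[OF ne])
      fix x y :: 'a assume x: "x \<noteq> 0" and y: "y \<noteq> 0"
      let ?l = "ennreal ((g x / ?\<omega> x - g y / ?\<omega> y)\<^sup>2 * ?\<omega> x * ?\<omega> y) + 2 * ennreal (U x * U y) + 2 * ennreal (V x * V y)"
      let ?r = "ennreal ((g x)\<^sup>2 / ?\<omega> x * ?\<omega> y) + ennreal ((g y)\<^sup>2 / ?\<omega> y * ?\<omega> x) + 2 * ennreal (U x * V y) + 2 * ennreal (V x * U y)"
      note pos = \<omega>[OF x] \<omega>[OF y]
      have "?l = ennreal ((g x / ?\<omega> x - g y / ?\<omega> y)\<^sup>2 * ?\<omega> x * ?\<omega> y + 2 * (U x * U y) + 2 * (V x * V y))"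
        using pos nonneg by (simp add: ennreal_plus ennreal_mult')
      also have "(g x / ?\<omega> x - g y / ?\<omega> y)\<^sup>2 * ?\<omega> x * ?\<omega> y + 2 * (U x * U y) + 2 * (V x * V y)
          = (g x)\<^sup>2 / ?\<omega> x * ?\<omega> y + (g y)\<^sup>2 / ?\<omega> y * ?\<omega> x + 2 * (U x * V y) + 2 * (V x * U y)"
      proof -
        have "(g x / ?\<omega> x - g y / ?\<omega> y)\<^sup>2 * ?\<omega> x * ?\<omega> y = (g x)\<^sup>2 / ?\<omega> x * ?\<omega> y + (g y)\<^sup>2 / ?\<omega> y * ?\<omega> x - 2 * (g x * g y)"
          using pos by (simp add: field_simps power2_eq_square)
        then show ?thesis by (simp add: g_def algebra_simps)
      qed
      also have "ennreal \<dots> = ?r"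
        using pos nonneg by (simp add: ennreal_plus ennreal_mult')
      finally have "?k (x - y) * ?l = ?k (x - y) * ?r" by (rule arg_cong)
      then show "?k (x - y) * ennreal ((g x / ?\<omega> x - g y / ?\<omega> y)\<^sup>2 * ?\<omega> x * ?\<omega> y)
          + 2 * (?k (x - y) * ennreal (U x * U y)) + 2 * (?k (x - y) * ennreal (V x * V y))
        = (?k (x - y) * ennreal ((g x)\<^sup>2 / ?\<omega> x * ?\<omega> y) + ?k (x - y) * ennreal ((g y)\<^sup>2 / ?\<omega> y * ?\<omega> x))
          + 2 * (?k (x - y) * ennreal (U x * V y)) + 2 * (?k (x - y) * ennreal (V x * U y))"
        unfolding distrib_left mult.left_commute[of 2] .
    qed
    also have "\<dots> = (B + B') + 2 * A U V + 2 * A V U"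
      unfolding B_def B'_def A_def by (simp add: nn_integral_add nn_integral_cmult)
    also have "\<dots> = 2 * B + 4 * A U V"
      unfolding AVU B' by (simp add: mult_2[symmetric] distrib_right[symmetric] add.assoc)
    finally show ?thesis .
  qed

  \<comment> \<open>From \<open>f x * f y \<le> ((f x)\<^sup>2 + (f y)\<^sup>2) / 2\<close>, written for the positive and negative parts.\<close>
  have density: "Q ?u ?u + Q ?v ?v \<le> (\<integral>\<^sup>+x. ennreal ((f x)\<^sup>2) \<partial>lborel) + 2 * Q ?u ?v"
  proof -
    have mass: "(\<integral>\<^sup>+x. ?\<kappa> x \<partial>lborel) \<le> 1"
      by (subst nn_integral_mixture)
        (simp_all add: nn_integral_approx_delta[OF b(1,2) \<epsilon>] approx_delta_eq_0)
    define H where "H = (\<integral>\<^sup>+x. (\<integral>\<^sup>+y. ?\<kappa> (x - y) * ennreal ((f x)\<^sup>2 / 2) \<partial>lborel) \<partial>lborel)"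
    have H: "H \<le> (\<integral>\<^sup>+x. ennreal ((f x)\<^sup>2 / 2) \<partial>lborel)"
      unfolding H_def using mult_right_mono[OF mass, of "\<integral>\<^sup>+x. ennreal ((f x)\<^sup>2 / 2) \<partial>lborel"]
      using nn_integral_conv_mass[of ?\<kappa> "\<lambda>x. ennreal ((f x)\<^sup>2 / 2)"] by simp
    define H' where "H' = (\<integral>\<^sup>+x. (\<integral>\<^sup>+y. ?\<kappa> (x - y) * ennreal ((f y)\<^sup>2 / 2) \<partial>lborel) \<partial>lborel)"
    have H': "H' = H"
      unfolding H_def H'_def using nn_integral_swap_even[of ?\<kappa> "\<lambda>x y. ennreal ((f x)\<^sup>2 / 2)"] by simp
    have QVU: "Q ?v ?u = Q ?u ?v"
      unfolding Q_def using nn_integral_swap_even[of ?\<kappa> "\<lambda>x y. ?u x * ?v y"]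
      by (simp add: mult.commute)
    have "Q ?u ?u + Q ?v ?v = (\<integral>\<^sup>+x. (\<integral>\<^sup>+y. ?\<kappa> (x - y) * (?u x * ?u y) + ?\<kappa> (x - y) * (?v x * ?v y) \<partial>lborel) \<partial>lborel)"
      unfolding Q_def by (simp add: nn_integral_add)
    also have "\<dots> \<le> (\<integral>\<^sup>+x. (\<integral>\<^sup>+y. (?\<kappa> (x - y) * ennreal ((f x)\<^sup>2 / 2) + ?\<kappa> (x - y) * ennreal ((f y)\<^sup>2 / 2))
         + (?\<kappa> (x - y) * (?u x * ?v y) + ?\<kappa> (x - y) * (?v x * ?u y)) \<partial>lborel) \<partial>lborel)"
    proof (intro nn_integral_mono)
      fix x y
      define p where "p z = max 0 (f z)" for z
      define n where "n z = max 0 (- f z)" for z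
      have pn: "ennreal (f z) = ennreal (p z)" "ennreal (- f z) = ennreal (n z)" "0 \<le> p z" "0 \<le> n z" "f z = p z - n z" for z
        by (auto simp: p_def n_def max_def ennreal_neg)
      have "0 \<le> (f x - f y)\<^sup>2" by simp
      then have "f x * f y \<le> (f x)\<^sup>2 / 2 + (f y)\<^sup>2 / 2"
        by (simp add: power2_eq_square algebra_simps)
      then have "p x * p y + n x * n y \<le> ((f x)\<^sup>2 / 2 + (f y)\<^sup>2 / 2) + (p x * n y + n x * p y)"
        unfolding pn(5)[of x] pn(5)[of y] by (simp add: algebra_simps)
      then have "ennreal (p x * p y + n x * n y) \<le> ennreal (((f x)\<^sup>2 / 2 + (f y)\<^sup>2 / 2) + (p x * n y + n x * p y))"
        by (rule ennreal_leI)
      then have "?u x * ?u y + ?v x * ?v y \<le> (ennreal ((f x)\<^sup>2 / 2) + ennreal ((f y)\<^sup>2 / 2)) + (?u x * ?v y + ?v x * ?u y)"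
        unfolding pn(1,2) using pn(3,4) by (simp add: ennreal_plus ennreal_mult)
      then have "?\<kappa> (x - y) * (?u x * ?u y + ?v x * ?v y) \<le> ?\<kappa> (x - y) * ((ennreal ((f x)\<^sup>2 / 2) + ennreal ((f y)\<^sup>2 / 2)) + (?u x * ?v y + ?v x * ?u y))"
        by (rule mult_left_mono) simp
      then show "?\<kappa> (x - y) * (?u x * ?u y) + ?\<kappa> (x - y) * (?v x * ?v y)
        \<le> (?\<kappa> (x - y) * ennreal ((f x)\<^sup>2 / 2) + ?\<kappa> (x - y) * ennreal ((f y)\<^sup>2 / 2))
         + (?\<kappa> (x - y) * (?u x * ?v y) + ?\<kappa> (x - y) * (?v x * ?u y))"
        unfolding distrib_left .
    qed
    also have "\<dots> = (H + H') + (Q ?u ?v + Q ?v ?u)"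
      unfolding Q_def H_def H'_def by (simp add: nn_integral_add)
    also have "\<dots> \<le> ((\<integral>\<^sup>+x. ennreal ((f x)\<^sup>2 / 2) \<partial>lborel) + (\<integral>\<^sup>+x. ennreal ((f x)\<^sup>2 / 2) \<partial>lborel)) + (Q ?u ?v + Q ?u ?v)"
      unfolding QVU H' by (intro add_right_mono add_mono H)
    also have "(\<integral>\<^sup>+x. ennreal ((f x)\<^sup>2 / 2) \<partial>lborel) + (\<integral>\<^sup>+x. ennreal ((f x)\<^sup>2 / 2) \<partial>lborel) = (\<integral>\<^sup>+x. ennreal ((f x)\<^sup>2) \<partial>lborel)"
      by (subst nn_integral_add[symmetric]) (auto simp: ennreal_plus[symmetric] simp del: ennreal_plus)
    finally show ?thesis by (simp add: mult_2)
  qed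

  have "D + 2 * Y \<le> 2 * (\<integral>\<^sup>+x. ennreal ((f x)\<^sup>2) \<partial>lborel)"
    using finU finV
    by (intro ennreal_cancel_combine[OF form hardy Ig E density]) (auto simp: I_def)
  then show ?thesis
    unfolding D_def Y_def g_def .
qed

section \<open>The ground state inequality\<close>

lemma ennreal_liminf_add_le:
  fixes f g :: "nat \<Rightarrow> ennreal"
  shows "liminf f + liminf g \<le> liminf (\<lambda>k. f k + g k)"
proof -
  have "liminf f + liminf g = (SUP n. (INF m\<in>{n..}. f m) + (INF m\<in>{n..}. g m))"
    unfolding liminf_SUP_INF
    by (rule ennreal_SUP_add[symmetric]) (auto simp: incseq_def intro!: INF_superset_mono)
  also have "\<dots> \<le> (SUP n. INF m\<in>{n..}. f m + g m)"
    by (intro SUP_subset_mono order.refl INF_greatest add_mono INF_lower) auto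
  finally show ?thesis by (simp add: liminf_SUP_INF)
qed

lemma tendsto_mult_ennreal:
  fixes A :: "nat \<Rightarrow> ennreal"
  assumes A: "A \<longlonglongrightarrow> c" and c: "c < top" and r: "r \<longlonglongrightarrow> l" and nn: "\<And>k. 0 \<le> r k"
  shows "(\<lambda>k. A k * ennreal (r k)) \<longlonglongrightarrow> c * ennreal l"
proof -
  have l: "0 \<le> l" using nn by (intro LIMSEQ_le_const[OF r]) auto
  have "eventually (\<lambda>k. A k < top) sequentially"
    using A c by (rule order_tendstoD)
  then have ev: "eventually (\<lambda>k. ennreal (enn2real (A k) * r k) = A k * ennreal (r k)) sequentially"
    by eventually_elim (simp add: ennreal_mult nn)
  have "(\<lambda>k. enn2real (A k)) \<longlonglongrightarrow> enn2real c"
    using A c by (intro tendsto_enn2real) auto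
  then have "(\<lambda>k. ennreal (enn2real (A k) * r k)) \<longlonglongrightarrow> ennreal (enn2real c * l)"
    by (intro tendsto_ennrealI tendsto_mult r)
  then have "(\<lambda>k. A k * ennreal (r k)) \<longlonglongrightarrow> ennreal (enn2real c * l)"
    using ev by (rule Lim_transform_eventually)
  then show ?thesis using c l by (simp add: ennreal_mult)
qed

text \<open>The truncation \<open>\<bar>f\<bar> \<le> k heat 1\<close> makes the Riesz energy finite and is increasing in \<open>k\<close>, so
  potentials of the truncations converge monotonically.\<close>
lemma potential_truncation:
  fixes u :: "'a::euclidean_space \<Rightarrow> ennreal"
  assumes [measurable]: "u \<in> borel_measurable borel" and b: "0 < b" "b < real DIM('a) / 2"
  defines "N \<equiv> mixture (weight 0 (b / 2)) :: 'a \<Rightarrow> ennreal"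
  defines "T \<equiv> \<lambda>k x. if u x \<le> ennreal (real k * heat 1 x) then u x else 0"
  shows "(\<integral>\<^sup>+x. conv N (T k) x * conv N (T k) x \<partial>lborel) < top"
    and "conv N (T k) x \<le> conv N u x"
    and "(\<And>x. u x < top) \<Longrightarrow> (\<lambda>k. conv N (T k) x) \<longlonglongrightarrow> conv N u x"
proof -
  have [measurable]: "N \<in> borel_measurable borel" unfolding N_def by measurable
  have [measurable]: "T k \<in> borel_measurable borel" for k unfolding T_def by measurable
  let ?h = "\<lambda>x::'a. ennreal (heat 1 x)"
  have le: "T k x \<le> ennreal (real k) * ?h x" for x
    by (simp add: T_def ennreal_mult)
  have "conv N (T k) x \<le> ennreal (real k) * conv N ?h x" for x
    using le by (subst conv_cmult_right[symmetric]) (auto intro!: conv_mono_AE)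
  then have "(\<integral>\<^sup>+x. conv N (T k) x * conv N (T k) x \<partial>lborel)
      \<le> (\<integral>\<^sup>+x. (ennreal (real k) * conv N ?h x) * (ennreal (real k) * conv N ?h x) \<partial>lborel)"
    by (intro nn_integral_mono mult_mono) auto
  also have "\<dots> = ennreal (real k) * ennreal (real k) * (\<integral>\<^sup>+x. conv N ?h x * conv N ?h x \<partial>lborel)"
    by (subst nn_integral_cmult[symmetric]) (auto simp: mult_ac)
  also have "\<dots> < top"
    using conv_riesz_heat_finite[OF b] by (simp add: N_def ennreal_mult_less_top)
  finally show "(\<integral>\<^sup>+x. conv N (T k) x * conv N (T k) x \<partial>lborel) < top" .
  show "conv N (T k) x \<le> conv N u x"
    by (rule conv_mono_AE) (simp add: T_def)
  assume fin: "\<And>x. u x < top"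
  show "(\<lambda>k. conv N (T k) x) \<longlonglongrightarrow> conv N u x"
    unfolding conv_def
  proof (rule nn_integral_LIMSEQ)
    show "incseq (\<lambda>k y. N (x - y) * T k y)"
    proof (intro incseq_SucI le_funI mult_left_mono)
      fix k and y :: 'a
      have "ennreal (real k * heat 1 y) \<le> ennreal (real (Suc k) * heat 1 y)"
        by (intro ennreal_leI mult_right_mono) auto
      then show "T k y \<le> T (Suc k) y"
        unfolding T_def by (auto intro: order_trans)
    qed simp
    show "(\<lambda>k. N (x - y) * T k y) \<longlonglongrightarrow> N (x - y) * u y" for y
    proof -
      obtain r where r: "u y = ennreal r" "0 \<le> r" using fin[of y] by (cases "u y") auto
      obtain k0 where "r / heat 1 y < real k0" using reals_Archimedean2 by blast
      then have k0: "r < real k0 * heat 1 y" using heat_pos[of 1 y] by (simp add: field_simps)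
      have "eventually (\<lambda>k. N (x - y) * u y = N (x - y) * T k y) sequentially"
        using eventually_ge_at_top[of k0]
      proof eventually_elim
        case (elim k)
        have "r \<le> real k * heat 1 y"
          using k0 mult_right_mono[of "real k0" "real k" "heat 1 y"] elim by simp
        then have "u y \<le> ennreal (real k * heat 1 y)" by (simp add: r)
        then show ?case by (simp add: T_def)
      qed
      then show ?thesis by (rule Lim_transform_eventually[OF tendsto_const])
    qed
  qed simp
qed

text \<open>The truncation level \<open>\<epsilon> = 1 / (k + 1)\<close> and the truncation of \<open>f\<close> at \<open>k * heat 1\<close> are removed in one
  passage to the limit.  Both terms on the left have almost everywhere convergent nonnegative
  integrands, and the right-hand side is uniformly bounded, so Fatou's lemma suffices.\<close>
lemma ground_state_inequality:
  fixes f U V :: "'a::euclidean_space \<Rightarrow> real"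
  assumes [measurable]: "f \<in> borel_measurable borel" "U \<in> borel_measurable borel" "V \<in> borel_measurable borel"
    and b: "0 < b" "b < 1" "b < real DIM('a) / 2"
    and U: "AE x in lborel. conv (mixture (weight 0 (b / 2))) (\<lambda>x. ennreal (f x)) x = ennreal (U x)"
    and V: "AE x in lborel. conv (mixture (weight 0 (b / 2))) (\<lambda>x. ennreal (- f x)) x = ennreal (V x)"
    and nonneg: "\<And>x. 0 \<le> U x" "\<And>x. 0 \<le> V x"
  defines "a \<equiv> (real DIM('a) / 2 + b) / 2"
  shows "(\<integral>\<^sup>+x. (\<integral>\<^sup>+y. mixture (weight 0 (- b)) (x - y) *
            ennreal (((U x - V x) / riesz a x - (U y - V y) / riesz a y)\<^sup>2 * riesz a x * riesz a y) \<partial>lborel) \<partial>lborel)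
      + 2 * (\<integral>\<^sup>+x. mixture (weight 0 (a - b)) x * ennreal ((U x - V x)\<^sup>2 / riesz a x) \<partial>lborel)
    \<le> 2 * (\<integral>\<^sup>+x. ennreal ((f x)\<^sup>2) \<partial>lborel)"
proof -
  let ?N = "mixture (weight 0 (b / 2)) :: 'a \<Rightarrow> ennreal"
  let ?\<omega> = "riesz a :: 'a \<Rightarrow> real"
  have a: "0 < a" "a < real DIM('a) / 2" "b < a" "a - b < real DIM('a) / 2" using b by (auto simp: a_def)
  have ne: "AE x in lborel. (x::'a) \<noteq> 0" "AE y in lborel. (y::'a) \<noteq> x" for x
    by (rule AE_lborel_singleton)+
  have \<omega>: "0 < ?\<omega> x" if "x \<noteq> 0" for x using riesz_pos[OF that a(1,2)] .
  define F where "F k x = (if \<bar>f x\<bar> \<le> real k * heat 1 x then f x else 0)" for k x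
  define e where "e k = 1 / real (Suc k)" for k
  have [measurable]: "F k \<in> borel_measurable borel" for k unfolding F_def by measurable
  have trunc: "(\<lambda>x. ennreal (F k x)) = (\<lambda>x. if ennreal (f x) \<le> ennreal (real k * heat 1 x) then ennreal (f x) else 0)"
    "(\<lambda>x. ennreal (- F k x)) = (\<lambda>x. if ennreal (- f x) \<le> ennreal (real k * heat 1 x) then ennreal (- f x) else 0)" for k
  proof -
    have h: "0 \<le> real k * heat 1 x" for x :: 'a by simp
    show "(\<lambda>x. ennreal (F k x)) = (\<lambda>x. if ennreal (f x) \<le> ennreal (real k * heat 1 x) then ennreal (f x) else 0)"
    proof
      fix x show "ennreal (F k x) = (if ennreal (f x) \<le> ennreal (real k * heat 1 x) then ennreal (f x) else 0)"
        using h[of x] by (cases "0 < f x") (auto simp: F_def ennreal_le_iff ennreal_neg)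
    qed
    show "(\<lambda>x. ennreal (- F k x)) = (\<lambda>x. if ennreal (- f x) \<le> ennreal (real k * heat 1 x) then ennreal (- f x) else 0)"
    proof
      fix x show "ennreal (- F k x) = (if ennreal (- f x) \<le> ennreal (real k * heat 1 x) then ennreal (- f x) else 0)"
        using h[of x] by (cases "f x < 0") (auto simp: F_def ennreal_le_iff ennreal_neg)
    qed
  qed
  note pot_u = potential_truncation[of "\<lambda>x. ennreal (f x)" b, OF _ b(1,3), folded trunc]
  note pot_v = potential_truncation[of "\<lambda>x. ennreal (- f x)" b, OF _ b(1,3), folded trunc]
  define U' where "U' k x = enn2real (conv ?N (\<lambda>x. ennreal (F k x)) x)" for k x
  define V' where "V' k x = enn2real (conv ?N (\<lambda>x. ennreal (- F k x)) x)" for k x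
  have [measurable]: "U' k \<in> borel_measurable borel" "V' k \<in> borel_measurable borel" for k
    unfolding U'_def V'_def by measurable
  define good where "good x \<longleftrightarrow> x \<noteq> 0 \<and> conv ?N (\<lambda>x. ennreal (f x)) x = ennreal (U x)
    \<and> conv ?N (\<lambda>x. ennreal (- f x)) x = ennreal (V x)" for x
  have good: "AE x in lborel. good x"
    using ne(1) U V unfolding good_def by eventually_elim simp
  have pot: "conv ?N (\<lambda>x. ennreal (F k x)) x = ennreal (U' k x)" "conv ?N (\<lambda>x. ennreal (- F k x)) x = ennreal (V' k x)"
    if "good x" for k x
  proof -
    have "conv ?N (\<lambda>x. ennreal (F k x)) x \<le> ennreal (U x)" "conv ?N (\<lambda>x. ennreal (- F k x)) x \<le> ennreal (V x)"
      using pot_u(2)[of k x] pot_v(2)[of k x] that unfolding good_def by auto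
    then have "conv ?N (\<lambda>x. ennreal (F k x)) x < top" "conv ?N (\<lambda>x. ennreal (- F k x)) x < top"
      by (auto intro: le_less_trans[OF _ ennreal_less_top])
    then show "conv ?N (\<lambda>x. ennreal (F k x)) x = ennreal (U' k x)" "conv ?N (\<lambda>x. ennreal (- F k x)) x = ennreal (V' k x)"
      by (simp_all add: U'_def V'_def)
  qed
  have lim: "(\<lambda>k. U' k x) \<longlonglongrightarrow> U x" "(\<lambda>k. V' k x) \<longlonglongrightarrow> V x" if "good x" for x
  proof -
    have "(\<lambda>k. conv ?N (\<lambda>x. ennreal (F k x)) x) \<longlonglongrightarrow> ennreal (U x)" "(\<lambda>k. conv ?N (\<lambda>x. ennreal (- F k x)) x) \<longlonglongrightarrow> ennreal (V x)"
      using pot_u(3)[of x] pot_v(3)[of x] that unfolding good_def by auto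
    then have "(\<lambda>k. U' k x) \<longlonglongrightarrow> enn2real (ennreal (U x))" "(\<lambda>k. V' k x) \<longlonglongrightarrow> enn2real (ennreal (V x))"
      unfolding U'_def V'_def by (auto intro!: tendsto_enn2real)
    then show "(\<lambda>k. U' k x) \<longlonglongrightarrow> U x" "(\<lambda>k. V' k x) \<longlonglongrightarrow> V x" by (simp_all add: nonneg)
  qed
  let ?r = "\<lambda>k x y. ((U' k x - V' k x) / ?\<omega> x - (U' k y - V' k y) / ?\<omega> y)\<^sup>2 * ?\<omega> x * ?\<omega> y"
  let ?s = "\<lambda>x y. ((U x - V x) / ?\<omega> x - (U y - V y) / ?\<omega> y)\<^sup>2 * ?\<omega> x * ?\<omega> y"
  define \<phi> where "\<phi> k x y = mixture (weight (e k) (- b)) (x - y) * ennreal (?r k x y)" for k and x y :: 'a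
  define \<theta> where "\<theta> k x = mixture (hardy_weight (e k) b a) x * ennreal ((U' k x - V' k x)\<^sup>2 / ?\<omega> x)" for k and x :: 'a
  have [measurable]: "(\<lambda>(x, y). \<phi> k x y) \<in> borel_measurable (borel \<Otimes>\<^sub>M borel)" "\<theta> k \<in> borel_measurable borel" for k
    unfolding \<phi>_def \<theta>_def by measurable
  have step: "(\<integral>\<^sup>+x. (\<integral>\<^sup>+y. \<phi> k x y \<partial>lborel) \<partial>lborel) + 2 * (\<integral>\<^sup>+x. \<theta> k x \<partial>lborel) \<le> 2 * (\<integral>\<^sup>+x. ennreal ((f x)\<^sup>2) \<partial>lborel)" for k
  proof -
    have AE: "AE x in lborel. conv ?N (\<lambda>x. ennreal (F k x)) x = ennreal (U' k x)"
        "AE x in lborel. conv ?N (\<lambda>x. ennreal (- F k x)) x = ennreal (V' k x)"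
      by (intro eventually_mono[OF good] pot; assumption)+
    have nn: "0 \<le> U' k x" "0 \<le> V' k x" for x by (simp_all add: U'_def V'_def)
    have "(\<integral>\<^sup>+x. ennreal (U' k x * U' k x) \<partial>lborel) = (\<integral>\<^sup>+x. conv ?N (\<lambda>x. ennreal (F k x)) x * conv ?N (\<lambda>x. ennreal (F k x)) x \<partial>lborel)"
      by (intro nn_integral_cong_AE eventually_mono[OF AE(1)]) (simp add: ennreal_mult nn)
    with pot_u(1)[of k] have fin_U: "(\<integral>\<^sup>+x. ennreal (U' k x * U' k x) \<partial>lborel) < top" by simp
    have "(\<integral>\<^sup>+x. ennreal (V' k x * V' k x) \<partial>lborel) = (\<integral>\<^sup>+x. conv ?N (\<lambda>x. ennreal (- F k x)) x * conv ?N (\<lambda>x. ennreal (- F k x)) x \<partial>lborel)"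
      by (intro nn_integral_cong_AE eventually_mono[OF AE(2)]) (simp add: ennreal_mult nn)
    with pot_v(1)[of k] have fin_V: "(\<integral>\<^sup>+x. ennreal (V' k x * V' k x) \<partial>lborel) < top" by simp
    have e: "0 < e k" by (simp add: e_def)
    have "(\<integral>\<^sup>+x. (\<integral>\<^sup>+y. \<phi> k x y \<partial>lborel) \<partial>lborel) + 2 * (\<integral>\<^sup>+x. \<theta> k x \<partial>lborel) \<le> 2 * (\<integral>\<^sup>+x. ennreal ((F k x)\<^sup>2) \<partial>lborel)"
      using ground_state_truncated[OF _ _ _ b e AE nn fin_U fin_V, folded a_def]
      unfolding \<phi>_def \<theta>_def by simp
    also have "\<dots> \<le> 2 * (\<integral>\<^sup>+x. ennreal ((f x)\<^sup>2) \<partial>lborel)"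
      by (intro mult_left_mono nn_integral_mono ennreal_leI) (auto simp: F_def)
    finally show ?thesis .
  qed
  have kernel_lim: "(\<lambda>k. mixture (weight (e k) (- b)) z) \<longlonglongrightarrow> mixture (weight 0 (- b)) z" for z :: 'a
    unfolding e_def by (rule mixture_incseq_tendsto[OF _ weight_incseq weight_tendsto]) simp
  have hardy_lim: "(\<lambda>k. mixture (hardy_weight (e k) b a) z) \<longlonglongrightarrow> mixture (weight 0 (a - b)) z" for z :: 'a
    unfolding e_def using b a by (intro mixture_incseq_tendsto hardy_weight_incseq hardy_weight_tendsto) auto
  have \<phi>_lim: "(\<lambda>k. \<phi> k x y) \<longlonglongrightarrow> mixture (weight 0 (- b)) (x - y) * ennreal (?s x y)" if "good x" "good y" "y \<noteq> x" for x y
  proof -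
    have pos: "0 < ?\<omega> x" "0 < ?\<omega> y" using that \<omega> by (auto simp: good_def)
    have "(\<lambda>k. ?r k x y) \<longlonglongrightarrow> ?s x y"
      using pos by (intro tendsto_intros lim that) auto
    moreover have "mixture (weight 0 (- b)) (x - y) < top"
      using that b by (subst mixture_weight) auto
    ultimately show ?thesis
      unfolding \<phi>_def using pos by (intro tendsto_mult_ennreal kernel_lim) auto
  qed
  have \<theta>_lim: "(\<lambda>k. \<theta> k x) \<longlonglongrightarrow> mixture (weight 0 (a - b)) x * ennreal ((U x - V x)\<^sup>2 / ?\<omega> x)" if "good x" for x
  proof -
    have pos: "0 < ?\<omega> x" using that \<omega> by (auto simp: good_def)
    have "(\<lambda>k. (U' k x - V' k x)\<^sup>2 / ?\<omega> x) \<longlonglongrightarrow> (U x - V x)\<^sup>2 / ?\<omega> x"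
      using pos by (intro tendsto_intros lim that) auto
    moreover have "mixture (weight 0 (a - b)) x < top"
      using that a by (subst mixture_weight) (auto simp: good_def)
    ultimately show ?thesis
      unfolding \<theta>_def using pos by (intro tendsto_mult_ennreal hardy_lim) auto
  qed
  have "(\<integral>\<^sup>+x. (\<integral>\<^sup>+y. mixture (weight 0 (- b)) (x - y) * ennreal (?s x y) \<partial>lborel) \<partial>lborel)
     \<le> (\<integral>\<^sup>+x. liminf (\<lambda>k. \<integral>\<^sup>+y. \<phi> k x y \<partial>lborel) \<partial>lborel)"
  proof (intro nn_integral_mono_AE eventually_mono[OF good])
    fix x assume x: "good x"
    have "(\<integral>\<^sup>+y. mixture (weight 0 (- b)) (x - y) * ennreal (?s x y) \<partial>lborel) = (\<integral>\<^sup>+y. liminf (\<lambda>k. \<phi> k x y) \<partial>lborel)"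
      using good ne(2)[of x]
      by (intro nn_integral_cong_AE, eventually_elim) (simp add: lim_imp_Liminf[OF _ \<phi>_lim[OF x]])
    also have "\<dots> \<le> liminf (\<lambda>k. \<integral>\<^sup>+y. \<phi> k x y \<partial>lborel)"
      by (rule nn_integral_liminf) measurable
    finally show "(\<integral>\<^sup>+y. mixture (weight 0 (- b)) (x - y) * ennreal (?s x y) \<partial>lborel) \<le> liminf (\<lambda>k. \<integral>\<^sup>+y. \<phi> k x y \<partial>lborel)" .
  qed
  also have "\<dots> \<le> liminf (\<lambda>k. \<integral>\<^sup>+x. (\<integral>\<^sup>+y. \<phi> k x y \<partial>lborel) \<partial>lborel)"
    by (rule nn_integral_liminf) measurable
  finally have D: "(\<integral>\<^sup>+x. (\<integral>\<^sup>+y. mixture (weight 0 (- b)) (x - y) * ennreal (?s x y) \<partial>lborel) \<partial>lborel)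
     \<le> liminf (\<lambda>k. \<integral>\<^sup>+x. (\<integral>\<^sup>+y. \<phi> k x y \<partial>lborel) \<partial>lborel)" .
  have "2 * (\<integral>\<^sup>+x. mixture (weight 0 (a - b)) x * ennreal ((U x - V x)\<^sup>2 / ?\<omega> x) \<partial>lborel)
     = (\<integral>\<^sup>+x. liminf (\<lambda>k. 2 * \<theta> k x) \<partial>lborel)"
    by (subst nn_integral_cmult[symmetric], measurable, intro nn_integral_cong_AE eventually_mono[OF good])
      (rule lim_imp_Liminf[OF _ ennreal_tendsto_cmult[OF _ \<theta>_lim], symmetric], simp_all)
  also have "\<dots> \<le> liminf (\<lambda>k. \<integral>\<^sup>+x. 2 * \<theta> k x \<partial>lborel)"
    by (rule nn_integral_liminf) measurable
  also have "(\<lambda>k. \<integral>\<^sup>+x. 2 * \<theta> k x \<partial>lborel) = (\<lambda>k. 2 * (\<integral>\<^sup>+x. \<theta> k x \<partial>lborel))"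
    by (simp add: nn_integral_cmult)
  finally have Y: "2 * (\<integral>\<^sup>+x. mixture (weight 0 (a - b)) x * ennreal ((U x - V x)\<^sup>2 / ?\<omega> x) \<partial>lborel)
     \<le> liminf (\<lambda>k. 2 * (\<integral>\<^sup>+x. \<theta> k x \<partial>lborel))" .
  have "liminf (\<lambda>k. (\<integral>\<^sup>+x. (\<integral>\<^sup>+y. \<phi> k x y \<partial>lborel) \<partial>lborel) + 2 * (\<integral>\<^sup>+x. \<theta> k x \<partial>lborel))
     \<le> liminf (\<lambda>k. 2 * (\<integral>\<^sup>+x. ennreal ((f x)\<^sup>2) \<partial>lborel))"
    by (intro Liminf_mono always_eventually allI step)
  also have "\<dots> = 2 * (\<integral>\<^sup>+x. ennreal ((f x)\<^sup>2) \<partial>lborel)"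
    by (simp add: Liminf_const)
  finally show ?thesis
    by (intro order_trans[OF add_mono[OF D Y]] order_trans[OF ennreal_liminf_add_le])
qed

section \<open>Riesz potentials of square-integrable functions\<close>

definition riesz_potential :: "real \<Rightarrow> ('a::euclidean_space \<Rightarrow> real) \<Rightarrow> 'a \<Rightarrow> real" where
  "riesz_potential \<gamma> f x = (LINT y|lborel. riesz (\<gamma> / 4) (x - y) * f y)"

lemma measurable_riesz_potential [measurable]:
  assumes [measurable]: "f \<in> borel_measurable borel"
  shows "riesz_potential \<gamma> f \<in> borel_measurable borel"
  unfolding riesz_potential_def by measurable

lemma riesz_nonneg: "0 < r \<Longrightarrow> r < real DIM('a) / 2 \<Longrightarrow> 0 \<le> riesz r (x::'a::euclidean_space)"
  unfolding riesz_def by (intro mult_nonneg_nonneg divide_nonneg_nonneg less_imp_le[OF Gamma_real_pos]) auto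

lemma conv_riesz_nn_integral:
  fixes u :: "'a::euclidean_space \<Rightarrow> real"
  assumes r: "0 < r" "r < real DIM('a) / 2"
  shows "conv (mixture (weight 0 r)) (\<lambda>y. ennreal (u y)) x = (\<integral>\<^sup>+y. ennreal (riesz r (x - y) * u y) \<partial>lborel)"
  unfolding conv_def
proof (intro nn_integral_cong_AE eventually_mono[OF AE_lborel_singleton[of x]])
  fix y assume "y \<noteq> x"
  then have "mixture (weight 0 r) (x - y) = ennreal (riesz r (x - y))"
    by (intro mixture_weight r) auto
  then show "mixture (weight 0 r) (x - y) * ennreal (u y) = ennreal (riesz r (x - y) * u y)"
    using riesz_nonneg[OF r, of "x - y"] by (simp add: ennreal_mult')
qed

text \<open>The case \<open>\<beta> = 0\<close> of the Stein--Weiss inequality shows that the potential of \<open>\<bar>f\<bar>\<close> has a finite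
  weighted norm.\<close>
lemma AE_riesz_integrable:
  fixes f :: "'a::euclidean_space \<Rightarrow> real"
  assumes [measurable]: "f \<in> borel_measurable borel"
    and L2: "(\<integral>\<^sup>+x. ennreal ((f x)\<^sup>2) \<partial>lborel) < top" and \<gamma>: "0 < \<gamma>" "\<gamma> < real DIM('a)"
  shows "AE x in lborel. integrable lborel (\<lambda>y. riesz (\<gamma> / 4) (x - y) * f y)"
proof -
  let ?N = "mixture (weight 0 (\<gamma> / 4)) :: 'a \<Rightarrow> ennreal"
  let ?w = "\<lambda>y. ennreal \<bar>f y\<bar>"
  have C: "0 < C_const DIM('a) 0" "0 < C_const DIM('a) \<gamma>" using \<gamma> by (auto intro: C_const_pos)
  have "(\<integral>\<^sup>+x. ennreal (norm x powr (- \<gamma>) / C_const DIM('a) \<gamma>) * (conv ?N ?w x)\<^sup>2 \<partial>lborel)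
    \<le> (\<integral>\<^sup>+x. ennreal (norm x powr (- 0) / C_const DIM('a) 0) * (?w x)\<^sup>2 \<partial>lborel)"
    using stein_weiss[of ?w 0 \<gamma>] \<gamma> by simp
  also have "\<dots> \<le> (\<integral>\<^sup>+x. ennreal (1 / C_const DIM('a) 0) * ennreal ((f x)\<^sup>2) \<partial>lborel)"
    using C by (intro nn_integral_mono mult_mono ennreal_leI) (auto simp: ennreal_power divide_right_mono)
  also have "\<dots> < top"
    using L2 by (simp add: nn_integral_cmult ennreal_mult_less_top)
  finally have fin: "(\<integral>\<^sup>+x. ennreal (norm x powr (- \<gamma>) / C_const DIM('a) \<gamma>) * (conv ?N ?w x)\<^sup>2 \<partial>lborel) < top" .
  have "AE x in lborel. ennreal (norm x powr (- \<gamma>) / C_const DIM('a) \<gamma>) * (conv ?N ?w x)\<^sup>2 \<noteq> \<infinity>"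
    by (rule nn_integral_PInf_AE) (use fin in auto)
  with AE_lborel_singleton[of "0::'a"] show ?thesis
  proof eventually_elim
    case (elim x)
    have "conv ?N ?w x \<noteq> top"
      using elim C by (auto simp: ennreal_mult_eq_top_iff power2_eq_square)
    moreover have "(\<integral>\<^sup>+y. ennreal (norm (riesz (\<gamma> / 4) (x - y) * f y)) \<partial>lborel) = conv ?N ?w x"
      using \<gamma> by (subst conv_riesz_nn_integral) (auto simp: abs_mult riesz_nonneg)
    ultimately show ?case
      by (intro integrableI_bounded) (auto simp: less_top)
  qed
qed

lemma riesz_potential_split:
  fixes f :: "'a::euclidean_space \<Rightarrow> real"
  assumes \<gamma>: "0 < \<gamma>" "\<gamma> < real DIM('a)"
    and int: "integrable lborel (\<lambda>y. riesz (\<gamma> / 4) (x - y) * f y)"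
  defines "N \<equiv> mixture (weight 0 (\<gamma> / 4)) :: 'a \<Rightarrow> ennreal"
  shows "conv N (\<lambda>y. ennreal (f y)) x < top" "conv N (\<lambda>y. ennreal (- f y)) x < top"
    "riesz_potential \<gamma> f x = enn2real (conv N (\<lambda>y. ennreal (f y)) x) - enn2real (conv N (\<lambda>y. ennreal (- f y)) x)"
proof -
  have r: "0 < \<gamma> / 4" "\<gamma> / 4 < real DIM('a) / 2" using \<gamma> by auto
  have c: "conv N (\<lambda>y. ennreal (f y)) x = (\<integral>\<^sup>+y. ennreal (riesz (\<gamma> / 4) (x - y) * f y) \<partial>lborel)"
    "conv N (\<lambda>y. ennreal (- f y)) x = (\<integral>\<^sup>+y. ennreal (- (riesz (\<gamma> / 4) (x - y) * f y)) \<partial>lborel)"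
    unfolding N_def conv_riesz_nn_integral[OF r] by simp_all
  show "conv N (\<lambda>y. ennreal (f y)) x < top" "conv N (\<lambda>y. ennreal (- f y)) x < top"
    using int unfolding c by (auto simp: real_integrable_def less_top)
  show "riesz_potential \<gamma> f x = enn2real (conv N (\<lambda>y. ennreal (f y)) x) - enn2real (conv N (\<lambda>y. ennreal (- f y)) x)"
    unfolding riesz_potential_def c using int by (rule real_lebesgue_integral_def)
qed

text \<open>The inequality for nonnegative functions transfers to \<open>f\<close> of either sign because
  \<open>riesz_potential \<alpha> f\<close> is the convolution of a positive kernel with \<open>riesz_potential \<beta> f\<close>.  To avoid
  signed integrals, the bound by the convolution with the absolute value is derived from the two
  inequalities \<open>u \<le> v + \<bar>u - v\<bar>\<close> and \<open>v \<le> u + \<bar>u - v\<bar>\<close> for the potentials of both parts of \<open>f\<close>.\<close>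
lemma stein_weiss_potential:
  fixes f :: "'a::euclidean_space \<Rightarrow> real"
  assumes f [measurable]: "f \<in> borel_measurable borel"
    and L2: "(\<integral>\<^sup>+x. ennreal ((f x)\<^sup>2) \<partial>lborel) < top"
    and \<beta>: "0 < \<beta>" "\<beta> \<le> \<alpha>" "\<alpha> < real DIM('a)"
  shows "(\<integral>\<^sup>+x. ennreal (norm x powr (- \<alpha>) / C_const DIM('a) \<alpha> * (riesz_potential \<alpha> f x)\<^sup>2) \<partial>lborel)
     \<le> (\<integral>\<^sup>+x. ennreal (norm x powr (- \<beta>) / C_const DIM('a) \<beta> * (riesz_potential \<beta> f x)\<^sup>2) \<partial>lborel)"
proof (cases "\<alpha> = \<beta>")
  case False
  let ?N = "\<lambda>r. mixture (weight 0 r) :: 'a \<Rightarrow> ennreal"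
  let ?u = "\<lambda>y. ennreal (f y)" and ?v = "\<lambda>y. ennreal (- f y)"
  let ?g = "\<lambda>y. ennreal \<bar>riesz_potential \<beta> f y\<bar>"
  define q where "q = (\<alpha> - \<beta>) / 4"
  have q: "0 < q" and \<alpha>: "q + \<beta> / 4 = \<alpha> / 4" using False \<beta> by (auto simp: q_def field_simps)
  have C: "0 < C_const DIM('a) \<alpha>" "0 < C_const DIM('a) \<beta>" using \<beta> by (auto intro: C_const_pos)
  have comp: "conv (?N (\<alpha> / 4)) p = conv (?N q) (conv (?N (\<beta> / 4)) p)" if [measurable]: "p \<in> borel_measurable borel" for p
    using q \<beta> by (simp add: conv_assoc[symmetric] conv_mixture_weight \<alpha>)
  have "AE x in lborel. conv (?N (\<beta> / 4)) ?u x \<le> conv (?N (\<beta> / 4)) ?v x + ?g x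
      \<and> conv (?N (\<beta> / 4)) ?v x \<le> conv (?N (\<beta> / 4)) ?u x + ?g x"
  proof (rule eventually_mono[OF AE_riesz_integrable[OF f L2, of \<beta>]])
    fix x assume int: "integrable lborel (\<lambda>y. riesz (\<beta> / 4) (x - y) * f y)"
    note split = riesz_potential_split[OF _ _ int]
    obtain s t where st: "conv (?N (\<beta> / 4)) ?u x = ennreal s" "conv (?N (\<beta> / 4)) ?v x = ennreal t" "0 \<le> s" "0 \<le> t"
      using split(1,2) \<beta> by (auto simp: less_top_ennreal)
    have "riesz_potential \<beta> f x = s - t" using split(3) \<beta> st by simp
    then show "conv (?N (\<beta> / 4)) ?u x \<le> conv (?N (\<beta> / 4)) ?v x + ?g x
      \<and> conv (?N (\<beta> / 4)) ?v x \<le> conv (?N (\<beta> / 4)) ?u x + ?g x"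
      unfolding st using st(3,4) by (auto simp: ennreal_plus[symmetric] ennreal_le_iff simp del: ennreal_plus)
  qed (use \<beta> in auto)
  then have le: "conv (?N (\<alpha> / 4)) ?u x \<le> conv (?N (\<alpha> / 4)) ?v x + conv (?N q) ?g x"
      "conv (?N (\<alpha> / 4)) ?v x \<le> conv (?N (\<alpha> / 4)) ?u x + conv (?N q) ?g x" for x
    by (simp_all add: comp conv_add_right[symmetric] conv_mono_AE)
  have "(\<integral>\<^sup>+x. ennreal (norm x powr (- \<alpha>) / C_const DIM('a) \<alpha> * (riesz_potential \<alpha> f x)\<^sup>2) \<partial>lborel)
     \<le> (\<integral>\<^sup>+x. ennreal (norm x powr (- \<alpha>) / C_const DIM('a) \<alpha>) * (conv (?N q) ?g x)\<^sup>2 \<partial>lborel)"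
  proof (intro nn_integral_mono_AE, rule eventually_mono[OF AE_riesz_integrable[OF f L2, of \<alpha>]])
    fix x assume int: "integrable lborel (\<lambda>y. riesz (\<alpha> / 4) (x - y) * f y)"
    note split = riesz_potential_split[OF _ _ int]
    obtain s t where st: "conv (?N (\<alpha> / 4)) ?u x = ennreal s" "conv (?N (\<alpha> / 4)) ?v x = ennreal t" "0 \<le> s" "0 \<le> t"
      using split(1,2) \<beta> by (auto simp: less_top_ennreal)
    have p: "riesz_potential \<alpha> f x = s - t" using split(3) \<beta> st by simp
    have "ennreal \<bar>riesz_potential \<alpha> f x\<bar> \<le> conv (?N q) ?g x"
    proof (cases "conv (?N q) ?g x")
      case (real w)
      then show ?thesis
        using le[of x] st(3,4) unfolding st p by (simp add: ennreal_plus[symmetric] ennreal_le_iff del: ennreal_plus)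
    qed simp
    then have "(ennreal \<bar>riesz_potential \<alpha> f x\<bar>)\<^sup>2 \<le> (conv (?N q) ?g x)\<^sup>2"
      by (rule power_mono) simp
    moreover have "ennreal (norm x powr (- \<alpha>) / C_const DIM('a) \<alpha> * (riesz_potential \<alpha> f x)\<^sup>2)
        = ennreal (norm x powr (- \<alpha>) / C_const DIM('a) \<alpha>) * (ennreal \<bar>riesz_potential \<alpha> f x\<bar>)\<^sup>2"
      using C by (subst ennreal_mult) (auto simp: ennreal_power)
    ultimately show "ennreal (norm x powr (- \<alpha>) / C_const DIM('a) \<alpha> * (riesz_potential \<alpha> f x)\<^sup>2)
        \<le> ennreal (norm x powr (- \<alpha>) / C_const DIM('a) \<alpha>) * (conv (?N q) ?g x)\<^sup>2"
      by (simp add: mult_left_mono)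
  qed (use \<beta> in auto)
  also have "\<dots> \<le> (\<integral>\<^sup>+x. ennreal (norm x powr (- \<beta>) / C_const DIM('a) \<beta>) * (?g x)\<^sup>2 \<partial>lborel)"
    unfolding q_def using False \<beta> by (intro stein_weiss) auto
  also have "\<dots> = (\<integral>\<^sup>+x. ennreal (norm x powr (- \<beta>) / C_const DIM('a) \<beta> * (riesz_potential \<beta> f x)\<^sup>2) \<partial>lborel)"
    using C by (intro nn_integral_cong, subst ennreal_mult) (auto simp: ennreal_power)
  finally show ?thesis .
qed simp

text \<open>The factor \<open>2\<close> matches the factor \<open>1/2\<close> in front of the double integral in a Dirichlet form with
  a given jump kernel.\<close>
lemma riesz_jump_kernel:
  fixes z :: "'a::euclidean_space"
  assumes "0 < \<beta>" "\<beta> < 2"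
  shows "riesz (- (\<beta> / 2)) z = 2 / D_const DIM('a) \<beta> / norm z powr (real DIM('a) + \<beta>)"
proof -
  let ?n = "real DIM('a)"
  have G: "0 < Gamma (1 - \<beta> / 2)" "0 < Gamma ((?n + \<beta>) / 2)" using assms by (auto intro!: Gamma_real_pos add_pos_pos)
  have g: "\<bar>Gamma (- (\<beta> / 2))\<bar> = Gamma (1 - \<beta> / 2) / (\<beta> / 2)" using assms by (intro abs_Gamma_minus) auto
  have p1: "pi powr (2 * - (\<beta> / 2) - ?n / 2) = 1 / pi powr (?n / 2 + \<beta>)"
    by (simp add: powr_minus_divide[symmetric] algebra_simps)
  have p2: "norm z powr (2 * - (\<beta> / 2) - ?n) = 1 / norm z powr (?n + \<beta>)"
    by (simp add: powr_minus_divide[symmetric] algebra_simps)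
  have p3: "?n / 2 - - (\<beta> / 2) = (?n + \<beta>) / 2" by (simp add: field_simps)
  show ?thesis
    unfolding riesz_def D_const_def p1 p2 p3 g using G assms by (simp add: field_simps)
qed

lemma weighted_inequality_real:
  fixes f :: "'a::euclidean_space \<Rightarrow> real"
  assumes f [measurable]: "f \<in> borel_measurable borel"
    and L2: "(\<integral>\<^sup>+x. ennreal ((f x)\<^sup>2) \<partial>lborel) < top"
    and \<beta>: "0 < \<beta>" "\<beta> < 2" "\<beta> \<le> \<alpha>" "\<alpha> < real DIM('a)"
  defines "h \<equiv> \<lambda>x. norm x powr ((real DIM('a) - \<beta>) / 2) * riesz_potential \<beta> f x"
  shows "(\<integral>\<^sup>+x. ennreal (norm x powr (- \<alpha>) / C_const DIM('a) \<alpha> * (riesz_potential \<alpha> f x)\<^sup>2) \<partial>lborel)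
     + (\<integral>\<^sup>+x. (\<integral>\<^sup>+y. ennreal (1 / D_const DIM('a) \<beta> * ((h x - h y)\<^sup>2 / norm (x - y) powr (real DIM('a) + \<beta>)
          * norm x powr (- (real DIM('a) - \<beta>) / 2) * norm y powr (- (real DIM('a) - \<beta>) / 2))) \<partial>lborel) \<partial>lborel)
     \<le> (\<integral>\<^sup>+x. ennreal ((f x)\<^sup>2) \<partial>lborel)"
proof -
  let ?n = "real DIM('a)"
  let ?N = "mixture (weight 0 (\<beta> / 4)) :: 'a \<Rightarrow> ennreal"
  let ?u = "\<lambda>y. ennreal (f y)" and ?v = "\<lambda>y. ennreal (- f y)"
  define b where "b = \<beta> / 2"
  define a where "a = (?n / 2 + b) / 2"
  have b: "0 < b" "b < 1" "b < ?n / 2" using \<beta> by (auto simp: b_def)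
  have a: "0 < a" "a < ?n / 2" using b by (auto simp: a_def)
  have ab: "a = (?n + \<beta>) / 4" "a - b = (?n - \<beta>) / 4" "b / 2 = \<beta> / 4" by (auto simp: a_def b_def field_simps)
  have ne: "AE x in lborel. (x::'a) \<noteq> 0" "AE y in lborel. (y::'a) \<noteq> x" for x
    by (rule AE_lborel_singleton)+
  have C: "0 < C_const DIM('a) \<alpha>" "0 < C_const DIM('a) \<beta>" using \<beta> by (auto intro: C_const_pos)
  have D: "0 < D_const DIM('a) \<beta>"
    unfolding D_const_def using \<beta> by (intro mult_pos_pos divide_pos_pos Gamma_real_pos) (auto intro: add_pos_pos)
  define U where "U x = enn2real (conv ?N ?u x)" for x
  define V where "V x = enn2real (conv ?N ?v x)" for x
  have [measurable]: "U \<in> borel_measurable borel" "V \<in> borel_measurable borel"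
    unfolding U_def V_def by measurable
  have split: "AE x in lborel. conv ?N ?u x = ennreal (U x) \<and> conv ?N ?v x = ennreal (V x) \<and> riesz_potential \<beta> f x = U x - V x"
    using riesz_potential_split[of \<beta> _ f] \<beta>
    by (intro eventually_mono[OF AE_riesz_integrable[OF f L2, of \<beta>]]) (auto simp: U_def V_def)
  let ?c = "\<lambda>x y. norm x powr (- (?n - \<beta>) / 2) * norm y powr (- (?n - \<beta>) / 2)"
  let ?E = "\<lambda>x y. 1 / D_const DIM('a) \<beta> * ((h x - h y)\<^sup>2 / norm (x - y) powr (?n + \<beta>)
          * norm x powr (- (?n - \<beta>) / 2) * norm y powr (- (?n - \<beta>) / 2))"
  have [measurable]: "h \<in> borel_measurable borel" unfolding h_def by measurable
  have ground: "(\<integral>\<^sup>+x. (\<integral>\<^sup>+y. mixture (weight 0 (- b)) (x - y) *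
            ennreal (((U x - V x) / riesz a x - (U y - V y) / riesz a y)\<^sup>2 * riesz a x * riesz a y) \<partial>lborel) \<partial>lborel)
      + 2 * (\<integral>\<^sup>+x. mixture (weight 0 (a - b)) x * ennreal ((U x - V x)\<^sup>2 / riesz a x) \<partial>lborel)
    \<le> 2 * (\<integral>\<^sup>+x. ennreal ((f x)\<^sup>2) \<partial>lborel)"
    unfolding a_def
  proof (rule ground_state_inequality[OF f _ _ b])
    show "AE x in lborel. conv (mixture (weight 0 (b / 2))) ?u x = ennreal (U x)"
      unfolding ab(3) by (rule eventually_mono[OF split]) simp
    show "AE x in lborel. conv (mixture (weight 0 (b / 2))) ?v x = ennreal (V x)"
      unfolding ab(3) by (rule eventually_mono[OF split]) simp
  qed (auto simp: U_def V_def)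
  have E: "(\<integral>\<^sup>+x. (\<integral>\<^sup>+y. mixture (weight 0 (- b)) (x - y) *
            ennreal (((U x - V x) / riesz a x - (U y - V y) / riesz a y)\<^sup>2 * riesz a x * riesz a y) \<partial>lborel) \<partial>lborel)
     = 2 * (\<integral>\<^sup>+x. (\<integral>\<^sup>+y. ennreal (?E x y) \<partial>lborel) \<partial>lborel)"
  proof -
    have "(\<integral>\<^sup>+y. mixture (weight 0 (- b)) (x - y) *
            ennreal (((U x - V x) / riesz a x - (U y - V y) / riesz a y)\<^sup>2 * riesz a x * riesz a y) \<partial>lborel)
       = 2 * (\<integral>\<^sup>+y. ennreal (?E x y) \<partial>lborel)" if x: "x \<noteq> 0" "riesz_potential \<beta> f x = U x - V x" for x
    proof -
      have "(\<integral>\<^sup>+y. mixture (weight 0 (- b)) (x - y) *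
            ennreal (((U x - V x) / riesz a x - (U y - V y) / riesz a y)\<^sup>2 * riesz a x * riesz a y) \<partial>lborel)
         = (\<integral>\<^sup>+y. 2 * ennreal (?E x y) \<partial>lborel)"
      proof (intro nn_integral_cong_AE eventually_mono[OF eventually_conj[OF split eventually_conj[OF ne]]])
        fix y assume y': "(conv ?N ?u y = ennreal (U y) \<and> conv ?N ?v y = ennreal (V y) \<and> riesz_potential \<beta> f y = U y - V y) \<and> y \<noteq> 0 \<and> y \<noteq> x"
        then have y: "riesz_potential \<beta> f y = U y - V y" "y \<noteq> 0" "y \<noteq> x" by auto
        define c where "c = pi powr (2 * a - ?n / 2) * Gamma (?n / 2 - a) / \<bar>Gamma a\<bar>"
        have c: "0 < c" unfolding c_def using a by (intro mult_pos_pos divide_pos_pos Gamma_real_pos) auto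
        have w: "riesz a z = c * norm z powr (- (?n - \<beta>) / 2)" for z :: 'a
        proof -
          have e: "2 * a - ?n = - (?n - \<beta>) / 2" by (simp add: ab field_simps)
          show ?thesis unfolding riesz_def c_def e ..
        qed
        \<comment> \<open>The kernel \<open>riesz a\<close> is \<open>c\<close> times the ground state in the definition of \<open>h\<close>; the constant cancels.\<close>
        have quot: "riesz_potential \<beta> f z / riesz a z = h z / c" for z
        proof -
          have m: "norm z powr (- (?n - \<beta>) / 2) = 1 / norm z powr ((?n - \<beta>) / 2)"
            by (simp only: minus_divide_left[symmetric] powr_minus_divide)
          show ?thesis unfolding w h_def m by simp
        qed
        have "((U x - V x) / riesz a x - (U y - V y) / riesz a y)\<^sup>2 * riesz a x * riesz a y
          = ((h x - h y) / c)\<^sup>2 * (c * norm x powr (- (?n - \<beta>) / 2)) * (c * norm y powr (- (?n - \<beta>) / 2))"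
          unfolding x(2)[symmetric] y(1)[symmetric] quot by (simp add: w diff_divide_distrib)
        also have "\<dots> = (h x - h y)\<^sup>2 * ?c x y"
          using c by (simp add: power_divide power2_eq_square)
        finally have r: "((U x - V x) / riesz a x - (U y - V y) / riesz a y)\<^sup>2 * riesz a x * riesz a y = (h x - h y)\<^sup>2 * ?c x y" .
        have "mixture (weight 0 (- b)) (x - y) = ennreal (2 / D_const DIM('a) \<beta> / norm (x - y) powr (?n + \<beta>))"
          using y(3) b \<beta> unfolding riesz_jump_kernel[OF \<beta>(1,2), symmetric] b_def by (intro mixture_weight) auto
        then have "mixture (weight 0 (- b)) (x - y) * ennreal (((U x - V x) / riesz a x - (U y - V y) / riesz a y)\<^sup>2 * riesz a x * riesz a y)
          = ennreal (2 / D_const DIM('a) \<beta> / norm (x - y) powr (?n + \<beta>) * ((h x - h y)\<^sup>2 * ?c x y))"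
          unfolding r using D by (simp only:) (intro ennreal_mult[symmetric]; simp)
        also have "\<dots> = ennreal (2 * ?E x y)"
          by (simp add: field_simps)
        also have "\<dots> = 2 * ennreal (?E x y)"
          by (subst ennreal_mult') auto
        finally show "mixture (weight 0 (- b)) (x - y) * ennreal (((U x - V x) / riesz a x - (U y - V y) / riesz a y)\<^sup>2 * riesz a x * riesz a y)
          = 2 * ennreal (?E x y)" .
      qed
      then show ?thesis by (simp add: nn_integral_cmult)
    qed
    then have "(\<integral>\<^sup>+x. (\<integral>\<^sup>+y. mixture (weight 0 (- b)) (x - y) *
            ennreal (((U x - V x) / riesz a x - (U y - V y) / riesz a y)\<^sup>2 * riesz a x * riesz a y) \<partial>lborel) \<partial>lborel)
      = (\<integral>\<^sup>+x. 2 * (\<integral>\<^sup>+y. ennreal (?E x y) \<partial>lborel) \<partial>lborel)"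
      by (intro nn_integral_cong_AE eventually_mono[OF eventually_conj[OF ne(1) split]]) auto
    then show ?thesis by (simp add: nn_integral_cmult)
  qed
  have H: "(\<integral>\<^sup>+x. mixture (weight 0 (a - b)) x * ennreal ((U x - V x)\<^sup>2 / riesz a x) \<partial>lborel)
     = (\<integral>\<^sup>+x. ennreal (norm x powr (- \<beta>) / C_const DIM('a) \<beta> * (riesz_potential \<beta> f x)\<^sup>2) \<partial>lborel)"
  proof (intro nn_integral_cong_AE eventually_mono[OF eventually_conj[OF ne(1) split]])
    fix x assume x: "x \<noteq> 0 \<and> conv ?N ?u x = ennreal (U x) \<and> conv ?N ?v x = ennreal (V x) \<and> riesz_potential \<beta> f x = U x - V x"
    have pos: "0 < riesz a x" using x a by (intro riesz_pos) auto
    have "mixture (weight 0 (a - b)) x = ennreal (norm x powr (- \<beta>) / C_const DIM('a) \<beta> * riesz a x)"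
      using x \<beta> unfolding ab(2) unfolding ab(1) by (subst mixture_weight) (auto simp: riesz_quotient)
    then show "mixture (weight 0 (a - b)) x * ennreal ((U x - V x)\<^sup>2 / riesz a x)
        = ennreal (norm x powr (- \<beta>) / C_const DIM('a) \<beta> * (riesz_potential \<beta> f x)\<^sup>2)"
      using pos C x by (simp add: ennreal_mult[symmetric])
  qed
  have halve: "S + E' \<le> F" if "2 * E' + 2 * H' \<le> 2 * F" "S \<le> H'" for S E' H' F :: ennreal
  proof -
    have "2 * (S + E') \<le> 2 * (E' + H')"
      using that(2) by (intro mult_left_mono) (simp_all add: add.commute add_left_mono)
    also have "\<dots> \<le> 2 * F" using that(1) by (simp add: distrib_left)
    finally show ?thesis by (subst (asm) ennreal_mult_le_mult_iff) simp_all
  qed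
  show ?thesis
    by (rule halve[OF ground[unfolded E H] stein_weiss_potential[OF f L2 \<beta>(1,3,4)]])
qed

section \<open>Complex-valued functions\<close>

lemma riesz_eq_sqrt_d_const:
  fixes z :: "'a::euclidean_space"
  assumes "0 < \<gamma>" "\<gamma> < real DIM('a)"
  shows "riesz (\<gamma> / 4) z = sqrt (d_const DIM('a) \<gamma>) * norm z powr (- real DIM('a) + \<gamma> / 2)"
proof -
  let ?n = "real DIM('a)"
  have G: "0 < Gamma ((2 * ?n - \<gamma>) / 4)" "0 < Gamma (\<gamma> / 4)" using assms by (auto intro!: Gamma_real_pos)
  have p: "pi powr (- (?n - \<gamma>)) = (pi powr (2 * (\<gamma> / 4) - ?n / 2))\<^sup>2"
    unfolding power2_eq_square powr_add[symmetric] by (rule arg_cong[where f="(powr) pi"]) (simp add: field_simps)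
  have g: "?n / 2 - \<gamma> / 4 = (2 * ?n - \<gamma>) / 4" and e: "2 * (\<gamma> / 4) - ?n = - ?n + \<gamma> / 2" by (simp_all add: field_simps)
  have "sqrt (d_const DIM('a) \<gamma>) = pi powr (2 * (\<gamma> / 4) - ?n / 2) * (Gamma ((2 * ?n - \<gamma>) / 4) / Gamma (\<gamma> / 4))"
    unfolding d_const_def p power_mult_distrib[symmetric] using G by (intro real_sqrt_unique) auto
  then show ?thesis
    unfolding riesz_def g e using G by simp
qed

lemma d_const_nonneg: "0 \<le> d_const n \<gamma>"
  by (simp add: d_const_def)

text \<open>Lebesgue measurable functions are replaced by Borel functions, for which integrals over
  products can be iterated.\<close>
lemma borel_representative:
  fixes f :: "'a::euclidean_space \<Rightarrow> complex"
  assumes f: "f \<in> borel_measurable lebesgue"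
  obtains g where "g \<in> borel_measurable borel" "AE x in lborel. f x = g x"
proof -
  have "(\<lambda>x. Re (f x)) \<in> borel_measurable lebesgue" "(\<lambda>x. Im (f x)) \<in> borel_measurable lebesgue"
    using f by measurable
  then obtain u v where uv: "u \<in> borel_measurable lborel" "AE x in lborel. Re (f x) = u x"
      "v \<in> borel_measurable lborel" "AE x in lborel. Im (f x) = v x"
    by (blast dest: completion_ex_borel_measurable_real)
  show thesis
  proof
    show "(\<lambda>x. Complex (u x) (v x)) \<in> borel_measurable borel"
      using uv(1,3) by (simp add: complex_eq[symmetric] Complex_eq)
    show "AE x in lborel. f x = Complex (u x) (v x)"
      using uv(2,4) by eventually_elim (simp add: complex_eq_iff)
  qed
qed

lemma riesz_conv_representative:
  assumes f: "f \<in> borel_measurable lebesgue" and [measurable]: "g \<in> borel_measurable borel"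
    and fg: "AE x in lborel. f x = g x"
  shows "riesz_conv \<gamma> f x = (LINT y|lborel. (norm (x - y) powr (- real CARD('n) + \<gamma> / 2)) *\<^sub>R g (y :: real ^ 'n))"
proof -
  let ?K = "\<lambda>y. norm (x - y) powr (- real CARD('n) + \<gamma> / 2)"
  have gm: "(\<lambda>y. ?K y *\<^sub>R g y) \<in> borel_measurable lborel" by measurable
  have "riesz_conv \<gamma> f x = (LINT y|lebesgue. ?K y *\<^sub>R g y)"
    unfolding riesz_conv_def
  proof (rule integral_cong_AE)
    show "(\<lambda>y. ?K y *\<^sub>R f y) \<in> borel_measurable lebesgue"
    proof (rule borel_measurable_scaleR[OF _ f])
      have "?K \<in> borel_measurable lborel" by measurable
      then show "?K \<in> borel_measurable lebesgue" by (rule measurable_completion)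
    qed
    show "(\<lambda>y. ?K y *\<^sub>R g y) \<in> borel_measurable lebesgue"
      using gm by (rule measurable_completion)
    show "AE y in lebesgue. ?K y *\<^sub>R f y = ?K y *\<^sub>R g y"
      by (rule AE_completion) (use fg in \<open>auto elim: eventually_mono\<close>)
  qed
  also have "\<dots> = (LINT y|lborel. ?K y *\<^sub>R g y)"
    by (rule integral_completion[OF gm])
  finally show ?thesis .
qed

lemma riesz_conv_potential:
  fixes g :: "real ^ 'n \<Rightarrow> complex"
  assumes [measurable]: "g \<in> borel_measurable borel"
    and L2: "(\<integral>\<^sup>+x. ennreal ((Re (g x))\<^sup>2) \<partial>lborel) < top" "(\<integral>\<^sup>+x. ennreal ((Im (g x))\<^sup>2) \<partial>lborel) < top"
    and \<gamma>: "0 < \<gamma>" "\<gamma> < real CARD('n)"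
  defines "R \<equiv> \<lambda>x. LINT y|lborel. (norm (x - y) powr (- real CARD('n) + \<gamma> / 2)) *\<^sub>R g y"
  shows "AE x in lborel. sqrt (d_const CARD('n) \<gamma>) * Re (R x) = riesz_potential \<gamma> (\<lambda>y. Re (g y)) x
    \<and> sqrt (d_const CARD('n) \<gamma>) * Im (R x) = riesz_potential \<gamma> (\<lambda>y. Im (g y)) x"
proof -
  let ?K = "\<lambda>x y. norm (x - y) powr (- real CARD('n) + \<gamma> / 2)"
  let ?s = "sqrt (d_const CARD('n) \<gamma>)"
  have \<gamma>': "\<gamma> < real DIM(real ^ 'n)" using \<gamma> by simp
  have K: "riesz (\<gamma> / 4) z = ?s * norm z powr (- real CARD('n) + \<gamma> / 2)" for z :: "real ^ 'n"
    using riesz_eq_sqrt_d_const[OF \<gamma>(1) \<gamma>', of z] by simp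
  have "0 < Gamma ((2 * real CARD('n) - \<gamma>) / 4)" "0 < Gamma (\<gamma> / 4)" using \<gamma> by (auto intro!: Gamma_real_pos)
  then have s: "0 < ?s" by (simp add: d_const_def)
  have "AE x in lborel. integrable lborel (\<lambda>y. riesz (\<gamma> / 4) (x - y) * Re (g y))"
    "AE x in lborel. integrable lborel (\<lambda>y. riesz (\<gamma> / 4) (x - y) * Im (g y))"
    using L2 \<gamma> \<gamma>' by (auto intro!: AE_riesz_integrable)
  then show ?thesis
  proof eventually_elim
    case (elim x)
    have "integrable lborel (\<lambda>y. ?K x y * Re (g y))" "integrable lborel (\<lambda>y. ?K x y * Im (g y))"
      using elim s by (simp_all add: K mult.assoc)
    then have "integrable lborel (\<lambda>y. complex_of_real (?K x y * Re (g y)) + \<i> * complex_of_real (?K x y * Im (g y)))"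
      by (intro Bochner_Integration.integrable_add integrable_mult_right integrable_of_real)
    also have "(\<lambda>y. complex_of_real (?K x y * Re (g y)) + \<i> * complex_of_real (?K x y * Im (g y))) = (\<lambda>y. ?K x y *\<^sub>R g y)"
      by (auto simp: complex_eq_iff)
    finally have int: "integrable lborel (\<lambda>y. ?K x y *\<^sub>R g y)" .
    show ?case
      using integral_Re[OF int] integral_Im[OF int]
      by (simp add: R_def riesz_potential_def K mult.assoc)
  qed
qed

text \<open>Each of the three terms is the sum of the corresponding terms for the real and the imaginary
  part of \<open>f\<close>, since almost everywhere the potential acts on the two parts separately.\<close>
theorem theorem2:
  fixes f :: "real ^ 'n \<Rightarrow> complex" and \<alpha> \<beta> :: real
  assumes "f \<in> borel_measurable lebesgue"
    and "integrable lebesgue (\<lambda>x. (cmod (f x))\<^sup>2)"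
    and "0 < \<beta>" and "\<beta> < 2" and "\<beta> \<le> \<alpha>" and "\<alpha> < real CARD('n)"
  shows "(\<integral>\<^sup>+ x. ennreal ((cmod (f x))\<^sup>2) \<partial>lebesgue) \<ge>
      ennreal (d_const CARD('n) \<alpha> / C_const CARD('n) \<alpha>) *
        (\<integral>\<^sup>+ x. ennreal (norm x powr (- \<alpha>) * (cmod (riesz_conv \<alpha> f x))\<^sup>2) \<partial>lebesgue)
    + ennreal (d_const CARD('n) \<beta> / D_const CARD('n) \<beta>) *
        (\<integral>\<^sup>+ (x, y). ennreal ((cmod (h_fun \<beta> f x - h_fun \<beta> f y))\<^sup>2
              / norm (x - y) powr (real CARD('n) + \<beta>)
              * norm x powr (- (real CARD('n) - \<beta>) / 2)
              * norm y powr (- (real CARD('n) - \<beta>) / 2))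
          \<partial>(lebesgue :: ((real ^ 'n) \<times> (real ^ 'n)) measure))"
proof -
  let ?n = "real CARD('n)"
  note \<beta> = assms(3-6)
  have \<beta>': "\<beta> < ?n" "0 < \<alpha>" "\<alpha> < real DIM(real ^ 'n)" using \<beta> by auto
  obtain g where g [measurable]: "g \<in> borel_measurable borel" and fg: "AE x in lborel. f x = g x"
    using borel_representative[OF assms(1)] by blast
  let ?u = "\<lambda>x. Re (g x)" and ?v = "\<lambda>x. Im (g x)"
  define R where "R \<gamma> x = (LINT y|lborel. (norm (x - y) powr (- ?n + \<gamma> / 2)) *\<^sub>R g y)" for \<gamma> and x :: "real ^ 'n"
  have R: "riesz_conv \<gamma> f x = R \<gamma> x" for \<gamma> x
    unfolding R_def by (rule riesz_conv_representative[OF assms(1) g fg])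
  have [measurable]: "R \<gamma> \<in> borel_measurable borel" for \<gamma>
    unfolding R_def by measurable
  have hf: "h_fun \<beta> f = (\<lambda>x. (norm x powr ((?n - \<beta>) / 2)) *\<^sub>R R \<beta> x)"
    unfolding h_fun_def R ..
  have [measurable]: "h_fun \<beta> f \<in> borel_measurable borel" unfolding hf by measurable
  define h where "h p x = norm x powr ((?n - \<beta>) / 2) * riesz_potential \<beta> p x" for p and x :: "real ^ 'n"
  have C: "0 < C_const CARD('n) \<alpha>" using \<beta> by (intro C_const_pos) auto
  have D: "0 < D_const CARD('n) \<beta>"
    unfolding D_const_def using \<beta> by (intro mult_pos_pos divide_pos_pos Gamma_real_pos) (auto intro: add_pos_pos)

  have mass: "(\<integral>\<^sup>+x. ennreal ((cmod (f x))\<^sup>2) \<partial>lebesgue) = (\<integral>\<^sup>+x. ennreal ((?u x)\<^sup>2) \<partial>lborel) + (\<integral>\<^sup>+x. ennreal ((?v x)\<^sup>2) \<partial>lborel)"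
  proof -
    have "(\<integral>\<^sup>+x. ennreal ((cmod (f x))\<^sup>2) \<partial>lebesgue) = (\<integral>\<^sup>+x. ennreal ((?u x)\<^sup>2) + ennreal ((?v x)\<^sup>2) \<partial>lborel)"
      unfolding nn_integral_completion
      by (intro nn_integral_cong_AE eventually_mono[OF fg]) (simp add: cmod_power2)
    then show ?thesis by (simp add: nn_integral_add)
  qed
  have "(\<integral>\<^sup>+x. ennreal ((cmod (f x))\<^sup>2) \<partial>lebesgue) < top"
    using assms(2) by (simp add: integrable_iff_bounded)
  then have L2: "(\<integral>\<^sup>+x. ennreal ((?u x)\<^sup>2) \<partial>lborel) < top" "(\<integral>\<^sup>+x. ennreal ((?v x)\<^sup>2) \<partial>lborel) < top"
    unfolding mass by simp_all
  note pot = riesz_conv_potential[OF g L2, folded R_def]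

  let ?S = "\<lambda>p. \<integral>\<^sup>+x. ennreal (norm x powr (- \<alpha>) / C_const CARD('n) \<alpha> * (riesz_potential \<alpha> p x)\<^sup>2) \<partial>lborel"
  have S: "ennreal (d_const CARD('n) \<alpha> / C_const CARD('n) \<alpha>) * (\<integral>\<^sup>+ x. ennreal (norm x powr (- \<alpha>) * (cmod (riesz_conv \<alpha> f x))\<^sup>2) \<partial>lebesgue)
    = ?S ?u + ?S ?v"
  proof -
    have "ennreal (d_const CARD('n) \<alpha> / C_const CARD('n) \<alpha>) * (\<integral>\<^sup>+ x. ennreal (norm x powr (- \<alpha>) * (cmod (riesz_conv \<alpha> f x))\<^sup>2) \<partial>lebesgue)
      = (\<integral>\<^sup>+ x. ennreal (d_const CARD('n) \<alpha> / C_const CARD('n) \<alpha>) * ennreal (norm x powr (- \<alpha>) * (cmod (R \<alpha> x))\<^sup>2) \<partial>lborel)"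
      unfolding nn_integral_completion R by (simp add: nn_integral_cmult)
    also have "\<dots> = (\<integral>\<^sup>+ x. ennreal (norm x powr (- \<alpha>) / C_const CARD('n) \<alpha> * (riesz_potential \<alpha> ?u x)\<^sup>2)
        + ennreal (norm x powr (- \<alpha>) / C_const CARD('n) \<alpha> * (riesz_potential \<alpha> ?v x)\<^sup>2) \<partial>lborel)"
    proof (intro nn_integral_cong_AE eventually_mono[OF pot[OF \<beta>'(2) \<beta>(4)]])
      fix x assume x: "sqrt (d_const CARD('n) \<alpha>) * Re (R \<alpha> x) = riesz_potential \<alpha> ?u x
        \<and> sqrt (d_const CARD('n) \<alpha>) * Im (R \<alpha> x) = riesz_potential \<alpha> ?v x"
      have "d_const CARD('n) \<alpha> * (cmod (R \<alpha> x))\<^sup>2 = (riesz_potential \<alpha> ?u x)\<^sup>2 + (riesz_potential \<alpha> ?v x)\<^sup>2"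
        unfolding x[THEN conjunct1, symmetric] x[THEN conjunct2, symmetric]
        by (simp add: power_mult_distrib d_const_nonneg cmod_power2 distrib_left)
      then have "norm x powr (- \<alpha>) / C_const CARD('n) \<alpha> * (d_const CARD('n) \<alpha> * (cmod (R \<alpha> x))\<^sup>2)
        = norm x powr (- \<alpha>) / C_const CARD('n) \<alpha> * ((riesz_potential \<alpha> ?u x)\<^sup>2 + (riesz_potential \<alpha> ?v x)\<^sup>2)"
        by (rule arg_cong)
      then have "d_const CARD('n) \<alpha> / C_const CARD('n) \<alpha> * (norm x powr (- \<alpha>) * (cmod (R \<alpha> x))\<^sup>2)
        = norm x powr (- \<alpha>) / C_const CARD('n) \<alpha> * ((riesz_potential \<alpha> ?u x)\<^sup>2 + (riesz_potential \<alpha> ?v x)\<^sup>2)"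
        by (simp add: mult_ac)
      then show "ennreal (d_const CARD('n) \<alpha> / C_const CARD('n) \<alpha>) * ennreal (norm x powr (- \<alpha>) * (cmod (R \<alpha> x))\<^sup>2)
        = ennreal (norm x powr (- \<alpha>) / C_const CARD('n) \<alpha> * (riesz_potential \<alpha> ?u x)\<^sup>2)
        + ennreal (norm x powr (- \<alpha>) / C_const CARD('n) \<alpha> * (riesz_potential \<alpha> ?v x)\<^sup>2)"
        using C d_const_nonneg[of "CARD('n)" \<alpha>] by (subst ennreal_mult[symmetric]) (auto simp: distrib_left)
    qed
    finally show ?thesis by (simp add: nn_integral_add)
  qed

  let ?W = "\<lambda>x y. norm x powr (- (?n - \<beta>) / 2) * norm y powr (- (?n - \<beta>) / 2)"
  let ?E = "\<lambda>p x y. ennreal (1 / D_const CARD('n) \<beta> * ((h p x - h p y)\<^sup>2 / norm (x - y) powr (?n + \<beta>)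
      * norm x powr (- (?n - \<beta>) / 2) * norm y powr (- (?n - \<beta>) / 2)))"
  let ?D = "\<lambda>p. \<integral>\<^sup>+x. (\<integral>\<^sup>+y. ?E p x y \<partial>lborel) \<partial>lborel"
  let ?H = "\<lambda>x y. ennreal ((cmod (h_fun \<beta> f x - h_fun \<beta> f y))\<^sup>2 / norm (x - y) powr (?n + \<beta>)
      * norm x powr (- (?n - \<beta>) / 2) * norm y powr (- (?n - \<beta>) / 2))"
  have [measurable]: "h p \<in> borel_measurable borel" if [measurable]: "p \<in> borel_measurable borel" for p
    unfolding h_def by measurable
  have E: "ennreal (d_const CARD('n) \<beta> / D_const CARD('n) \<beta>) * (\<integral>\<^sup>+ (x, y). ?H x y \<partial>(lebesgue :: ((real ^ 'n) \<times> (real ^ 'n)) measure))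
    = ?D ?u + ?D ?v"
  proof -
    let ?P = "\<lambda>x. sqrt (d_const CARD('n) \<beta>) * Re (R \<beta> x) = riesz_potential \<beta> ?u x
        \<and> sqrt (d_const CARD('n) \<beta>) * Im (R \<beta> x) = riesz_potential \<beta> ?v x"
    note P = pot[OF \<beta>(1) \<beta>'(1)]
    define H where "H x y = ?H x y" for x y
    have H [measurable]: "(\<lambda>(x, y). H x y) \<in> borel_measurable (borel \<Otimes>\<^sub>M borel)"
      unfolding H_def by measurable
    have "(\<integral>\<^sup>+ (x, y). H x y \<partial>(lebesgue :: ((real ^ 'n) \<times> (real ^ 'n)) measure)) = (\<integral>\<^sup>+ z. (\<lambda>(x, y). H x y) z \<partial>(lborel \<Otimes>\<^sub>M lborel))"
      unfolding nn_integral_completion lborel_prod ..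
    also have "\<dots> = (\<integral>\<^sup>+x. (\<integral>\<^sup>+y. (\<lambda>(x, y). H x y) (x, y) \<partial>lborel) \<partial>lborel)"
      by (rule lborel.nn_integral_fst[symmetric]) measurable
    finally have "(\<integral>\<^sup>+ (x, y). H x y \<partial>(lebesgue :: ((real ^ 'n) \<times> (real ^ 'n)) measure)) = (\<integral>\<^sup>+x. (\<integral>\<^sup>+y. H x y \<partial>lborel) \<partial>lborel)"
      by simp
    then have "ennreal (d_const CARD('n) \<beta> / D_const CARD('n) \<beta>) * (\<integral>\<^sup>+ (x, y). H x y \<partial>(lebesgue :: ((real ^ 'n) \<times> (real ^ 'n)) measure))
      = (\<integral>\<^sup>+x. (\<integral>\<^sup>+y. ennreal (d_const CARD('n) \<beta> / D_const CARD('n) \<beta>) * H x y \<partial>lborel) \<partial>lborel)"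
      by (simp add: nn_integral_cmult)
    then have "ennreal (d_const CARD('n) \<beta> / D_const CARD('n) \<beta>) * (\<integral>\<^sup>+ (x, y). ?H x y \<partial>(lebesgue :: ((real ^ 'n) \<times> (real ^ 'n)) measure))
      = (\<integral>\<^sup>+x. (\<integral>\<^sup>+y. ennreal (d_const CARD('n) \<beta> / D_const CARD('n) \<beta>) * ?H x y \<partial>lborel) \<partial>lborel)"
      unfolding H_def .
    also have "\<dots> = (\<integral>\<^sup>+x. (\<integral>\<^sup>+y. ?E ?u x y + ?E ?v x y \<partial>lborel) \<partial>lborel)"
    proof (intro nn_integral_cong_AE eventually_mono[OF P])
      fix x y assume x: "?P x" and y: "?P y"
      have h: "h ?u z = sqrt (d_const CARD('n) \<beta>) * Re (h_fun \<beta> f z)" "h ?v z = sqrt (d_const CARD('n) \<beta>) * Im (h_fun \<beta> f z)" if "?P z" for z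
        unfolding h_def that[THEN conjunct1, symmetric] that[THEN conjunct2, symmetric] hf by simp_all
      have "d_const CARD('n) \<beta> * (cmod (h_fun \<beta> f x - h_fun \<beta> f y))\<^sup>2 = (h ?u x - h ?u y)\<^sup>2 + (h ?v x - h ?v y)\<^sup>2"
        unfolding h[OF x] h[OF y] right_diff_distrib[symmetric]
        by (simp add: power_mult_distrib d_const_nonneg cmod_power2 distrib_left)
      then have *: "(cmod (h_fun \<beta> f x - h_fun \<beta> f y))\<^sup>2 * d_const CARD('n) \<beta> = (h ?u x - h ?u y)\<^sup>2 + (h ?v x - h ?v y)\<^sup>2"
        by (simp add: mult.commute)
      have "d_const CARD('n) \<beta> / D_const CARD('n) \<beta> * ((cmod (h_fun \<beta> f x - h_fun \<beta> f y))\<^sup>2 / norm (x - y) powr (?n + \<beta>)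
          * norm x powr (- (?n - \<beta>) / 2) * norm y powr (- (?n - \<beta>) / 2))
        = ((cmod (h_fun \<beta> f x - h_fun \<beta> f y))\<^sup>2 * d_const CARD('n) \<beta>) / D_const CARD('n) \<beta> / norm (x - y) powr (?n + \<beta>) * ?W x y"
        by simp
      also have "\<dots> = 1 / D_const CARD('n) \<beta> * ((h ?u x - h ?u y)\<^sup>2 / norm (x - y) powr (?n + \<beta>)
            * norm x powr (- (?n - \<beta>) / 2) * norm y powr (- (?n - \<beta>) / 2))
          + 1 / D_const CARD('n) \<beta> * ((h ?v x - h ?v y)\<^sup>2 / norm (x - y) powr (?n + \<beta>)
            * norm x powr (- (?n - \<beta>) / 2) * norm y powr (- (?n - \<beta>) / 2))"
        unfolding * by (simp add: add_divide_distrib distrib_right)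
      finally have eq: "d_const CARD('n) \<beta> / D_const CARD('n) \<beta> * ((cmod (h_fun \<beta> f x - h_fun \<beta> f y))\<^sup>2 / norm (x - y) powr (?n + \<beta>)
          * norm x powr (- (?n - \<beta>) / 2) * norm y powr (- (?n - \<beta>) / 2))
        = 1 / D_const CARD('n) \<beta> * ((h ?u x - h ?u y)\<^sup>2 / norm (x - y) powr (?n + \<beta>)
            * norm x powr (- (?n - \<beta>) / 2) * norm y powr (- (?n - \<beta>) / 2))
          + 1 / D_const CARD('n) \<beta> * ((h ?v x - h ?v y)\<^sup>2 / norm (x - y) powr (?n + \<beta>)
            * norm x powr (- (?n - \<beta>) / 2) * norm y powr (- (?n - \<beta>) / 2))" .
      have nonneg: "0 \<le> 1 / D_const CARD('n) \<beta> * (r\<^sup>2 / norm (x - y) powr (?n + \<beta>)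
            * norm x powr (- (?n - \<beta>) / 2) * norm y powr (- (?n - \<beta>) / 2))" for r
        using D by simp
      show "ennreal (d_const CARD('n) \<beta> / D_const CARD('n) \<beta>) * ?H x y = ?E ?u x y + ?E ?v x y"
        using D d_const_nonneg[of "CARD('n)" \<beta>]
        by (subst ennreal_mult[symmetric], simp, simp, subst eq, intro ennreal_plus nonneg)
    qed
    finally show ?thesis by (simp add: nn_integral_add)
  qed

  have main: "?S p + ?D p \<le> (\<integral>\<^sup>+x. ennreal ((p x)\<^sup>2) \<partial>lborel)"
    if "p \<in> borel_measurable borel" "(\<integral>\<^sup>+x. ennreal ((p x)\<^sup>2) \<partial>lborel) < top" for p :: "real ^ 'n \<Rightarrow> real"
    using weighted_inequality_real[OF that \<beta>(1-3) \<beta>'(3)] by (simp add: h_def)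
  have swap: "(A + B) + (A' + B') = (A + A') + (B + B')" for A B A' B' :: ennreal
    by (simp only: ac_simps)
  have "(?S ?u + ?S ?v) + (?D ?u + ?D ?v) = (?S ?u + ?D ?u) + (?S ?v + ?D ?v)"
    by (rule swap)
  also have "\<dots> \<le> (\<integral>\<^sup>+x. ennreal ((?u x)\<^sup>2) \<partial>lborel) + (\<integral>\<^sup>+x. ennreal ((?v x)\<^sup>2) \<partial>lborel)"
    by (intro add_mono main L2) measurable
  finally show ?thesis unfolding S E mass .
qed

end
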